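(* For every prime $p\geq 5$, the GGS-group $\mathcal{G}=\langle a,b\rangle\leq\operatorname{Aut}T$ with constant defining vector, acting on the $p$-regular rooted tree $T$, has the $p$-CSP but does not have the CSP.
   Context: $T$ is the infinite rooted tree in which every vertex has exactly $p$ children, and $\psi:\operatorname{Aut}T\to\operatorname{Aut}T\wr\operatorname{Sym}(p)$ is the natural isomorphism obtained by identifying each subtree rooted at a first-level vertex with $T$; elements fixing the first level are identified with their images in $\operatorname{Aut}T\times\overset{p}{\cdots}\times\operatorname{Aut}T$. The GGS-group with constant defining vector is $\mathcal{G}=\langle a,b\rangle$, where $a$ rigidly permutes the $p$ subtrees rooted at the first level according to the cycle $(1\,2\,\dots\,p)$, and $b$ fixes the first level and is defined recursively by $\psi(b)=(a,a,\dots,a,b)$ ($p-1$ entries equal to $a$). For $G\le\operatorname{Aut}T$, $\mathrm{st}_G(n)$ is the subgroup of elements of $G$ fixing every vertex at distance $n$ from the root. $G$ has the $p$-CSP if every $N\unlhd G$ such that $G/N$ is a finite $p$-group contains $\mathrm{st}_G(n)$ for some $n$; $G$ has the CSP (congruence subgroup property) if every finite index subgroup of $G$ contains $\mathrm{st}_G(n)$ for some $n$. *)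

theory Defs
  imports "HOL-Algebra.Algebra" "HOL-Computational_Algebra.Primes"
begin

text \<open>
  Vertices of the \<open>p\<close>-regular rooted tree are words over \<open>{0..<p}\<close>: the root is the empty word,
  the children of \<open>u\<close> are the words \<open>u @ [x]\<close>, and the distance of a vertex from the root is its length.
\<close>

definition vertices :: "nat \<Rightarrow> nat list set" where
  "vertices p = lists {..<p}"

definition is_child :: "nat list \<Rightarrow> nat list \<Rightarrow> bool" where
  "is_child v u \<longleftrightarrow> (\<exists>x. v = u @ [x])"

text \<open>
  Preserving the directed parent-child relation forces the root, the only vertex without a parent,
  to be fixed. Automorphisms are extensional functions, as everywhere in \<^const>\<open>BijGroup\<close>.
\<close>

definition tree_auts :: "nat \<Rightarrow> (nat list \<Rightarrow> nat list) set" where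
  "tree_auts p = {f \<in> Bij (vertices p).
     \<forall>u\<in>vertices p. \<forall>v\<in>vertices p. is_child (f v) (f u) \<longleftrightarrow> is_child v u}"

definition AutT :: "nat \<Rightarrow> (nat list \<Rightarrow> nat list) monoid" where
  "AutT p = BijGroup (vertices p) \<lparr>carrier := tree_auts p\<rparr>"

fun a_word :: "nat \<Rightarrow> nat list \<Rightarrow> nat list" where
  "a_word p [] = []"
| "a_word p (x # w) = Suc x mod p # w"

text \<open>
  The recursion \<open>\<psi>(b) = (a, \<dots>, a, b)\<close>: the last letter is \<open>p - 1\<close>.
\<close>

fun b_word :: "nat \<Rightarrow> nat list \<Rightarrow> nat list" where
  "b_word p [] = []"
| "b_word p (x # w) = x # (if Suc x < p then a_word p w else b_word p w)"

definition ggs_a :: "nat \<Rightarrow> nat list \<Rightarrow> nat list" where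
  "ggs_a p = restrict (a_word p) (vertices p)"

definition ggs_b :: "nat \<Rightarrow> nat list \<Rightarrow> nat list" where
  "ggs_b p = restrict (b_word p) (vertices p)"

definition GGS :: "nat \<Rightarrow> (nat list \<Rightarrow> nat list) monoid" where
  "GGS p = AutT p \<lparr>carrier := generate (AutT p) {ggs_a p, ggs_b p}\<rparr>"

text \<open>
  In the following, \<open>G\<close> is a subgroup of \<open>AutT p\<close>, viewed as a group in its own right.
\<close>

definition level_stab :: "nat \<Rightarrow> (nat list \<Rightarrow> nat list) monoid \<Rightarrow> nat \<Rightarrow> (nat list \<Rightarrow> nat list) set" where
  "level_stab p G n = {g \<in> carrier G. \<forall>v\<in>vertices p. length v = n \<longrightarrow> g v = v}"

definition finite_p_group :: "nat \<Rightarrow> ('a, 'b) monoid_scheme \<Rightarrow> bool" where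
  "finite_p_group p G \<longleftrightarrow> group G \<and> finite (carrier G) \<and> (\<exists>k. order G = p ^ k)"

definition has_p_CSP :: "nat \<Rightarrow> (nat list \<Rightarrow> nat list) monoid \<Rightarrow> bool" where
  "has_p_CSP p G \<longleftrightarrow>
     (\<forall>N. N \<lhd> G \<and> finite_p_group p (G Mod N) \<longrightarrow> (\<exists>n. level_stab p G n \<subseteq> N))"

definition has_CSP :: "nat \<Rightarrow> (nat list \<Rightarrow> nat list) monoid \<Rightarrow> bool" where
  "has_CSP p G \<longleftrightarrow>
     (\<forall>H. subgroup H G \<and> finite (rcosets\<^bsub>G\<^esub> H) \<longrightarrow> (\<exists>n. level_stab p G n \<subseteq> H))"


subsection \<open>Well-definedness\<close>

lemma vertices_simps [simp]:
  "[] \<in> vertices p" "x # w \<in> vertices p \<longleftrightarrow> x < p \<and> w \<in> vertices p"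
  by (auto simp: vertices_def)

lemma subgroup_tree_auts: "subgroup (tree_auts p) (BijGroup (vertices p))"
proof (rule group.subgroupI[OF group_BijGroup])
  let ?V = "vertices p"
  show "tree_auts p \<subseteq> carrier (BijGroup ?V)"
    by (auto simp: tree_auts_def BijGroup_def)
  have "(\<lambda>x\<in>?V. x) \<in> tree_auts p"
    by (simp add: tree_auts_def id_Bij)
  then show "tree_auts p \<noteq> {}" by blast
next
  let ?V = "vertices p"
  fix f assume f: "f \<in> tree_auts p"
  then have fB: "f \<in> Bij ?V" by (simp add: tree_auts_def)
  then have inj: "f ` ?V = ?V" by (simp add: Bij_def bij_betw_def)
  have "is_child (inv_into ?V f v) (inv_into ?V f u) \<longleftrightarrow> is_child v u"
    if "u \<in> ?V" "v \<in> ?V" for u v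
  proof -
    have "inv_into ?V f u \<in> ?V" "inv_into ?V f v \<in> ?V"
      using that inj by (auto intro: inv_into_into)
    then have "is_child (f (inv_into ?V f v)) (f (inv_into ?V f u))
        \<longleftrightarrow> is_child (inv_into ?V f v) (inv_into ?V f u)"
      using f by (simp add: tree_auts_def)
    then show ?thesis using that inj by (simp add: f_inv_into_f)
  qed
  then show "inv\<^bsub>BijGroup ?V\<^esub> f \<in> tree_auts p"
    using fB by (simp add: inv_BijGroup tree_auts_def restrict_inv_into_Bij)
next
  let ?V = "vertices p"
  fix f g assume f: "f \<in> tree_auts p" and g: "g \<in> tree_auts p"
  then have B: "f \<in> Bij ?V" "g \<in> Bij ?V" by (auto simp: tree_auts_def)
  then have "g x \<in> ?V" if "x \<in> ?V" for x
    using that Bij_imp_funcset by blast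
  then show "f \<otimes>\<^bsub>BijGroup ?V\<^esub> g \<in> tree_auts p"
    using f g B by (simp add: BijGroup_def tree_auts_def compose_Bij compose_eq)
qed

lemma group_AutT: "group (AutT p)"
  unfolding AutT_def by (rule group.subgroup_imp_group[OF group_BijGroup subgroup_tree_auts])

lemma tree_autsI:
  assumes maps: "\<And>w. w \<in> vertices p \<Longrightarrow> f w \<in> vertices p"
    and inj: "\<And>v w. v \<in> vertices p \<Longrightarrow> w \<in> vertices p \<Longrightarrow> f v = f w \<Longrightarrow> v = w"
    and len: "\<And>w. w \<in> vertices p \<Longrightarrow> length (f w) = length w"
    and take: "\<And>w. w \<in> vertices p \<Longrightarrow> f (butlast w) = butlast (f w)"
  shows "restrict f (vertices p) \<in> tree_auts p"
proof -
  let ?V = "vertices p"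
  have inj': "inj_on f ?V" using inj by (auto simp: inj_on_def)
  have "w \<in> f ` ?V" if "w \<in> ?V" for w
  proof -
    let ?L = "{v. set v \<subseteq> {..<p} \<and> length v = length w}"
    have L: "?L \<subseteq> ?V" by (auto simp: vertices_def)
    have "f ` ?L = ?L"
    proof (rule endo_inj_surj)
      show "finite ?L" by (rule finite_lists_length_eq) simp
      show "f ` ?L \<subseteq> ?L" using maps len by (auto simp: vertices_def subset_iff in_lists_conv_set)
      show "inj_on f ?L" using inj' L by (rule inj_on_subset)
    qed
    moreover have "w \<in> ?L" using that by (auto simp: vertices_def)
    ultimately show ?thesis using L by blast
  qed
  then have "bij_betw f ?V ?V" using maps inj' by (auto simp: bij_betw_def)
  then have B: "restrict f ?V \<in> Bij ?V"
    by (auto simp: Bij_def cong: bij_betw_cong)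
  have child: "is_child v u \<longleftrightarrow> v \<noteq> [] \<and> butlast v = u" for u v
    by (auto simp: is_child_def) (metis append_butlast_last_id)
  have "is_child (f v) (f u) \<longleftrightarrow> is_child v u" if uv: "u \<in> ?V" "v \<in> ?V" for u v
  proof -
    have "butlast v \<in> ?V"
      using uv by (auto simp: vertices_def in_lists_conv_set dest: in_set_butlastD)
    then have "f (butlast v) = f u \<longleftrightarrow> butlast v = u" using inj uv by metis
    moreover have "f v = [] \<longleftrightarrow> v = []" using len[OF uv(2)] by (metis length_0_conv)
    ultimately show ?thesis using take[OF uv(2)] by (simp add: child)
  qed
  then show ?thesis using B by (simp add: tree_auts_def)
qed

lemma a_word_facts:
  assumes "w \<in> vertices p"
  shows "a_word p w \<in> vertices p" "length (a_word p w) = length w"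
    "a_word p (butlast w) = butlast (a_word p w)"
  using assms by (cases w; auto)+

lemma a_word_inj:
  "v \<in> vertices p \<Longrightarrow> w \<in> vertices p \<Longrightarrow> a_word p v = a_word p w \<Longrightarrow> v = w"
  by (cases v; cases w; auto simp: mod_Suc split: if_splits)

lemma b_word_facts:
  assumes "w \<in> vertices p"
  shows "b_word p w \<in> vertices p" "length (b_word p w) = length w"
    "b_word p (butlast w) = butlast (b_word p w)"
proof -
  show "b_word p w \<in> vertices p" and len: "length (b_word p w) = length w"
    using assms by (induction w) (auto simp: a_word_facts)
  show "b_word p (butlast w) = butlast (b_word p w)"
    using assms
  proof (induction w)
    case (Cons x w)
    have "length (b_word p w) = length w" if "w \<in> vertices p" for w
      using that by (induction w) (auto simp: a_word_facts)
    then show ?case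
      using Cons a_word_facts[of w p] by (cases w) auto
  qed simp
qed

lemma b_word_inj:
  "v \<in> vertices p \<Longrightarrow> w \<in> vertices p \<Longrightarrow> b_word p v = b_word p w \<Longrightarrow> v = w"
proof (induction v arbitrary: w)
  case Nil
  then show ?case by (cases w) auto
next
  case (Cons x v)
  then show ?case by (cases w) (auto split: if_splits dest: a_word_inj)
qed

lemma ggs_gens_in_AutT: "ggs_a p \<in> carrier (AutT p)" "ggs_b p \<in> carrier (AutT p)"
  unfolding AutT_def ggs_a_def ggs_b_def
  by (auto intro!: tree_autsI a_word_facts b_word_facts dest: a_word_inj b_word_inj)

lemma group_GGS: "group (GGS p)"
  unfolding GGS_def
  by (intro group.subgroup_imp_group group.generate_is_subgroup group_AutT)
    (auto simp: ggs_gens_in_AutT)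

end

theory Submission
  imports Defs "HOL-Computational_Algebra.Computational_Algebra"
begin

text \<open>
  Let \<open>\<zeta>\<close> be the class of the variable in \<open>A = \<int>[\<zeta>] / (1 + \<zeta> + \<dots> + \<zeta>\<^sup>p\<^sup>-\<^sup>1)\<close>. The affine maps
  \<open>t \<mapsto> \<zeta> t\<close> and \<open>t \<mapsto> \<zeta> t + 1\<close> of \<open>A\<close> define an action of \<open>G = \<langle>a, b\<rangle>\<close>, where \<open>a\<close> acts by the first and
  \<open>b\<close> by the second: the translation part \<open>T\<close> of a word is a \<open>\<zeta>\<close>-weighted sum of the translation parts
  of its first-level sections, so induction on the number of letters \<open>b\<close> shows that relations of \<open>G\<close>
  act trivially. Let \<open>K\<close> be the kernel of the linear part and \<open>R\<close> the kernel of the action; then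
  \<open>K / R \<cong> A\<close> through \<open>T\<close>, and \<open>R\<close> is the commutator subgroup of \<open>K\<close>.

  No CSP: evaluating \<open>\<zeta>\<close> at \<open>2\<close> gives an action on \<open>\<int> / (2\<^sup>p - 1)\<close>. The stabilizer of \<open>0\<close> has finite index,
  but contains no level stabilizer, since some \<open>p\<close>-power of \<open>b a\<^sup>-\<^sup>1\<close> lies in that while \<open>b a\<^sup>-\<^sup>1\<close> acts as
  \<open>t \<mapsto> t + 1\<close> and \<open>2\<^sup>p - 1\<close> is prime to \<open>p\<close>.

  \<open>p\<close>-CSP: let \<open>N\<close> be normal of index \<open>p\<^sup>s\<close>, and let \<open>R\<^sub>n\<close> be the product of the copies of \<open>R\<close> planted at
  the vertices of level \<open>n\<close>; \<open>R\<close> is regular branch, that is \<open>R\<^sub>1 \<subseteq> R\<close>.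
  (1) \<open>R\<^sub>n \<subseteq> N\<close> for some \<open>n\<close>: at a vertex where the image in \<open>G / N\<close> of the planted copy of \<open>R\<close> is as small
  as possible, the copies planted at its children all have the same image, which therefore commutes
  with the planted copies of \<open>K\<close>; for \<open>p \<ge> 4\<close> this forces the copies one level below into \<open>N\<close>.
  (2) Every level stabilizer of large level lies in \<open>N R\<^sub>n\<close>: deep stabilizers have \<open>T\<close>-values divisible by
  high powers of \<open>\<zeta> - 1\<close>, hence by \<open>p\<^sup>s\<close>, so their elements are \<open>p\<^sup>s\<close>-th powers modulo \<open>R\<close>; and an element
  of \<open>R\<close> in a deep stabilizer is a \<open>p\<^sup>s\<close>-th power of an element of \<open>R\<close> modulo \<open>R\<^sub>1\<close>, because the section
  values of \<open>R\<close> are cut out of \<open>A\<^sup>p\<close> by linear equations and \<open>A\<close> is torsion-free.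
\<close>

section \<open>Groups of tree automorphisms\<close>

class mult_group = monoid_mult + inverse +
  assumes mult_group_left_inverse [simp]: "inverse x * x = 1"
begin

lemma mult_group_cancel_left [simp]: "inverse x * (x * y) = y"
  by (simp flip: mult.assoc)

lemma mult_group_right_inverse [simp]: "x * inverse x = 1"
proof -
  have "x * inverse x = inverse (inverse x) * (inverse x * (x * inverse x))"
    by (rule mult_group_cancel_left[symmetric])
  also have "\<dots> = 1"
    by (simp only: mult_group_cancel_left mult_group_left_inverse)
  finally show ?thesis .
qed

lemma mult_group_cancel_right [simp]: "x * (inverse x * y) = y"
  by (simp flip: mult.assoc)

lemma mult_group_inverse_unique: "x * y = 1 \<Longrightarrow> inverse x = y"
  by (metis mult_group_cancel_left mult_1_right)

lemma mult_group_inverse_mult: "inverse (x * y) = inverse y * inverse x"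
  by (rule mult_group_inverse_unique) (simp add: mult.assoc)

lemma mult_group_inverse_inverse [simp]: "inverse (inverse x) = x"
  by (rule mult_group_inverse_unique) simp

lemma mult_group_inverse_one [simp]: "inverse 1 = 1"
  by (rule mult_group_inverse_unique) simp

lemma mult_group_eq_one: "x * inverse y = 1 \<Longrightarrow> x = y"
  by (metis mult.assoc mult_1_left mult_1_right mult_group_left_inverse)

lemma mult_group_power_inverse: "inverse x ^ n = inverse (x ^ n)"
proof (induction n)
  case (Suc n)
  have "inverse (x ^ Suc n) = inverse x * inverse (x ^ n)"
    unfolding power_Suc2 mult_group_inverse_mult ..
  then show ?case using Suc by simp
qed simp

lemmas word_simps = mult.assoc mult_group_inverse_mult

end

definition commutator :: "'a::mult_group \<Rightarrow> 'a \<Rightarrow> 'a" where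
  "commutator x y = x * y * inverse x * inverse y"

lemma commutator_eq_one_iff: "commutator x y = 1 \<longleftrightarrow> x * y = y * x"
proof
  show "commutator x y = 1" if "x * y = y * x"
    using that by (simp add: commutator_def mult.assoc)
  assume "commutator x y = 1"
  then have "(x * y) * inverse (y * x) = 1"
    by (simp add: commutator_def word_simps)
  then show "x * y = y * x" by (rule mult_group_eq_one)
qed

definition is_subgroup :: "'a::mult_group set \<Rightarrow> bool" where
  "is_subgroup H \<longleftrightarrow> 1 \<in> H \<and> (\<forall>x\<in>H. \<forall>y\<in>H. x * y \<in> H) \<and> (\<forall>x\<in>H. inverse x \<in> H)"

lemma is_subgroupD:
  assumes "is_subgroup H"
  shows "1 \<in> H" "\<And>x y. x \<in> H \<Longrightarrow> y \<in> H \<Longrightarrow> x * y \<in> H" "\<And>x. x \<in> H \<Longrightarrow> inverse x \<in> H"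
    "\<And>x n. x \<in> H \<Longrightarrow> x ^ n \<in> H"
proof -
  show *: "1 \<in> H" "\<And>x y. x \<in> H \<Longrightarrow> y \<in> H \<Longrightarrow> x * y \<in> H" "\<And>x. x \<in> H \<Longrightarrow> inverse x \<in> H"
    using assms by (auto simp: is_subgroup_def)
  show "x ^ n \<in> H" if "x \<in> H" for x n
    by (induction n) (auto simp: * that)
qed

lemma is_subgroup_Int: "is_subgroup H \<Longrightarrow> is_subgroup K \<Longrightarrow> is_subgroup (H \<inter> K)"
  by (auto simp: is_subgroup_def)

definition is_normal :: "'a::mult_group set \<Rightarrow> 'a set \<Rightarrow> bool" where
  "is_normal N G \<longleftrightarrow> N \<subseteq> G \<and> is_subgroup N \<and> (\<forall>g\<in>G. \<forall>x\<in>N. g * x * inverse g \<in> N)"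

lemma is_normalD:
  assumes "is_normal N G"
  shows "x \<in> N \<Longrightarrow> x \<in> G" "is_subgroup N" "g \<in> G \<Longrightarrow> x \<in> N \<Longrightarrow> g * x * inverse g \<in> N"
    "1 \<in> N" "x \<in> N \<Longrightarrow> y \<in> N \<Longrightarrow> x * y \<in> N" "x \<in> N \<Longrightarrow> inverse x \<in> N"
  using assms by (auto simp: is_normal_def is_subgroup_def)

section \<open>Automorphisms of the tree of all words over \<open>nat\<close>\<close>

typedef tree_aut = "{f :: nat list \<Rightarrow> nat list.
    bij f \<and> (\<forall>v. length (f v) = length v) \<and> (\<forall>n v. f (take n v) = take n (f v))}"
  morphisms app Abs_tree_aut
  by (rule exI[of _ id]) auto

lemma app_facts: "bij (app g)" "length (app g v) = length v" "app g (take n v) = take n (app g v)"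
  using app[of g] by auto

lemma app_eqI: "(\<And>v. app g v = app h v) \<Longrightarrow> g = h"
  by (simp add: app_inject[symmetric] ext)

lemma app_Nil [simp]: "app g [] = []"
  using app_facts(2)[of g "[]"] by simp

instantiation tree_aut :: mult_group
begin

definition one_tree_aut :: tree_aut where
  "one_tree_aut = Abs_tree_aut id"

definition times_tree_aut :: "tree_aut \<Rightarrow> tree_aut \<Rightarrow> tree_aut" where
  "times_tree_aut g h = Abs_tree_aut (app g \<circ> app h)"

definition inverse_tree_aut :: "tree_aut \<Rightarrow> tree_aut" where
  "inverse_tree_aut g = Abs_tree_aut (inv_into UNIV (app g))"

definition divide_tree_aut :: "tree_aut \<Rightarrow> tree_aut \<Rightarrow> tree_aut" where
  "divide_tree_aut g h = g * inverse h"

lemma app_one [simp]: "app 1 v = v"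
  by (simp add: one_tree_aut_def Abs_tree_aut_inverse)

lemma app_mult [simp]: "app (g * h) v = app g (app h v)"
  unfolding times_tree_aut_def
  by (subst Abs_tree_aut_inverse) (auto simp: app_facts intro: bij_comp)

lemma app_inverse: "app (inverse g) = inv_into UNIV (app g)"
proof -
  have surj: "app g (inv_into UNIV (app g) v) = v" for v
    using app_facts(1) by (simp add: bij_is_surj surj_f_inv_f)
  have "length (inv_into UNIV (app g) v) = length v" for v
    using app_facts(2)[of g "inv_into UNIV (app g) v"] surj by simp
  moreover have "inv_into UNIV (app g) (take n v) = take n (inv_into UNIV (app g) v)" for n v
  proof -
    have "app g (take n (inv_into UNIV (app g) v)) = take n v"
      by (simp add: app_facts surj)
    then show ?thesis
      using app_facts(1)[of g] by (metis bij_inv_eq_iff)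
  qed
  ultimately show ?thesis
    unfolding inverse_tree_aut_def
    by (subst Abs_tree_aut_inverse) (auto simp: app_facts bij_imp_bij_inv)
qed

instance
proof
  fix f g h :: tree_aut
  show "f * g * h = f * (g * h)" "1 * g = g" "g * 1 = g"
    by (auto intro!: app_eqI)
  show "inverse g * g = 1"
    using app_facts(1)[of g] by (auto intro!: app_eqI simp: app_inverse bij_is_inj)
qed

end

section \<open>First-level action and sections\<close>

definition rt :: "tree_aut \<Rightarrow> nat \<Rightarrow> nat" where
  "rt g x = hd (app g [x])"

definition sec :: "tree_aut \<Rightarrow> nat \<Rightarrow> tree_aut" where
  "sec g x = Abs_tree_aut (\<lambda>w. tl (app g (x # w)))"

text \<open>The section really is a tree automorphism, since the section of \<open>inverse g\<close>
  at \<open>rt g x\<close> inverts it. From here on this equation takes the place of the definitions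
  through \<open>hd\<close> and \<open>tl\<close>.\<close>

lemma app_Cons: "app g (x # w) = rt g x # app (sec g x) w"
proof -
  have split: "app g (x # w) = rt g x # tl (app g (x # w))" for g x w
  proof -
    have "take 1 (app g (x # w)) = app g [x]"
      by (simp flip: app_facts(3))
    moreover have "length (app g (x # w)) = Suc (length w)"
      by (simp add: app_facts)
    ultimately show ?thesis
      by (cases "app g (x # w)") (auto simp: rt_def, metis list.sel(1))
  qed
  let ?f = "\<lambda>w. tl (app g (x # w))"
  have inv: "rt (inverse g) (rt g x) = x"
  proof -
    have "app (inverse g) (app g [x]) = [x]"
      by (simp flip: app_mult)
    then show ?thesis
      by (metis app_Nil list.sel(1) rt_def split)
  qed
  have "bij ?f"
  proof (rule o_bij)
    let ?h = "\<lambda>w. tl (app (inverse g) (rt g x # w))"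
    have "app (inverse g) (rt g x # ?f w) = x # w" for w
      using split[of g x w] by (metis app_mult app_one mult_group_left_inverse)
    then show "?h \<circ> ?f = id" by auto
    have "app g (x # ?h w) = rt g x # w" for w
      using split[of "inverse g" "rt g x" w] inv
      by (metis app_mult app_one mult_group_right_inverse)
    then show "?f \<circ> ?h = id" by auto
  qed
  moreover have "?f (take n w) = take n (?f w)" for n w
  proof -
    have "app g (x # take n w) = take (Suc n) (app g (x # w))"
      by (simp flip: app_facts(3))
    then show ?thesis by (simp add: tl_take)
  qed
  ultimately have "app (sec g x) = ?f"
    unfolding sec_def by (intro Abs_tree_aut_inverse) (simp add: app_facts)
  then show ?thesis using split by simp
qed

lemma tree_aut_eqI: "(\<And>x. rt g x = rt h x) \<Longrightarrow> (\<And>x. sec g x = sec h x) \<Longrightarrow> g = h"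
proof (rule app_eqI)
  assume *: "\<And>x. rt g x = rt h x" "\<And>x. sec g x = sec h x"
  show "app g v = app h v" for v
    by (cases v) (simp_all add: app_Cons *)
qed

lemma rt_mult [simp]: "rt (g * h) x = rt g (rt h x)"
  and sec_mult [simp]: "sec (g * h) x = sec g (rt h x) * sec h x"
proof -
  have *: "rt (g * h) x = rt g (rt h x)"
      "app (sec (g * h) x) w = app (sec g (rt h x) * sec h x) w" for w
    using app_mult[of g h "x # w"] by (simp_all only: app_Cons list.inject app_mult)
  show "rt (g * h) x = rt g (rt h x)" by (rule *)
  show "sec (g * h) x = sec g (rt h x) * sec h x" by (rule app_eqI) (rule *)
qed

lemma rt_one [simp]: "rt 1 x = x" and sec_one [simp]: "sec 1 x = 1"
proof -
  have *: "rt 1 x = x" "app (sec 1 x) w = w" for w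
    using app_Cons[of 1 x w] by simp_all
  show "rt 1 x = x" by (rule *)
  show "sec 1 x = 1" by (rule app_eqI) (simp add: *)
qed

lemma Abs_tree_aut_facts:
  assumes "bij f" "\<And>v. length (f v) = length v" "\<And>n v. f (take n v) = take n (f v)"
  shows "app (Abs_tree_aut f) = f"
  using assms by (intro Abs_tree_aut_inverse) auto

text \<open>The inverse of \<open>\<psi>\<close> on the automorphisms that fix the first
  level.\<close>

definition branch :: "(nat \<Rightarrow> tree_aut) \<Rightarrow> tree_aut" where
  "branch f = Abs_tree_aut (\<lambda>v. case v of [] \<Rightarrow> [] | x # w \<Rightarrow> x # app (f x) w)"

lemma app_branch: "app (branch f) = (\<lambda>v. case v of [] \<Rightarrow> [] | x # w \<Rightarrow> x # app (f x) w)"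
  unfolding branch_def
proof (rule Abs_tree_aut_facts)
  let ?F = "\<lambda>f v. case v of [] \<Rightarrow> [] | x # w \<Rightarrow> x # app (f x) w"
  show "bij (?F f)"
  proof (rule o_bij)
    show "?F (\<lambda>x. inverse (f x)) \<circ> ?F f = id" "?F f \<circ> ?F (\<lambda>x. inverse (f x)) = id"
      by (auto simp: fun_eq_iff split: list.split simp flip: app_mult)
  qed
  show "length (?F f v) = length v" for v
    by (cases v) (auto simp: app_facts)
  show "?F f (take n v) = take n (?F f v)" for n v
    by (cases v; cases n) (auto simp: app_facts)
qed

lemma rt_branch [simp]: "rt (branch f) x = x" and sec_branch [simp]: "sec (branch f) = f"
proof -
  have *: "rt (branch f) x = x" "app (sec (branch f) x) w = app (f x) w" for x w
    using app_Cons[of "branch f" x w] by (auto simp: app_branch)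
  show "rt (branch f) x = x" by (rule *)
  show "sec (branch f) = f" by (intro ext app_eqI) (rule *)
qed

lemma branch_sec: "(\<And>x. rt g x = x) \<Longrightarrow> branch (sec g) = g"
  by (rule tree_aut_eqI) auto

lemma branch_mult: "branch f * branch g = branch (\<lambda>x. f x * g x)"
  by (rule tree_aut_eqI) auto

lemma branch_one: "branch (\<lambda>x. 1) = 1"
  by (rule tree_aut_eqI) auto

lemma branch_inverse: "inverse (branch f) = branch (\<lambda>x. inverse (f x))"
  by (rule mult_group_inverse_unique) (simp add: branch_mult branch_one)

lemma branch_power: "branch f ^ n = branch (\<lambda>x. f x ^ n)"
  by (induction n) (simp_all add: branch_one branch_mult)

lemma branch_eq_iff [simp]: "branch f = branch g \<longleftrightarrow> f = g"
  by (metis sec_branch)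

section \<open>Copies planted at a vertex\<close>

definition plant1 :: "nat \<Rightarrow> tree_aut \<Rightarrow> tree_aut" where
  "plant1 i r = branch ((\<lambda>_. 1)(i := r))"

lemma plant1_mult: "plant1 i (r * s) = plant1 i r * plant1 i s"
  by (auto simp: plant1_def branch_mult fun_eq_iff)

lemma plant1_one [simp]: "plant1 i 1 = 1"
  by (simp add: plant1_def fun_upd_idem branch_one)

lemma plant1_inverse: "plant1 i (inverse r) = inverse (plant1 i r)"
  by (auto simp: plant1_def branch_inverse fun_eq_iff)

primrec plant :: "nat list \<Rightarrow> tree_aut \<Rightarrow> tree_aut" where
  "plant [] r = r"
| "plant (x # u) r = plant1 x (plant u r)"

lemma plant_mult: "plant u (r * s) = plant u r * plant u s"
  by (induction u) (simp_all add: plant1_mult)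

lemma plant_one [simp]: "plant u 1 = 1"
  by (induction u) simp_all

lemma plant_inverse: "plant u (inverse r) = inverse (plant u r)"
  by (induction u) (simp_all add: plant1_inverse)

lemma plant_append: "plant (u @ v) r = plant u (plant v r)"
  by (induction u) simp_all

text \<open>
  Tree automorphisms act on all words over the natural numbers, so that their type does not depend
  on \<open>p\<close>; the two generators fix the letters from \<open>p\<close> on and have trivial sections there.
\<close>

definition rot_word :: "nat \<Rightarrow> nat list \<Rightarrow> nat list" where
  "rot_word p v = (case v of [] \<Rightarrow> [] | x # w \<Rightarrow> (if x < p then Suc x mod p else x) # w)"

fun dir_word :: "nat \<Rightarrow> nat list \<Rightarrow> nat list" where
  "dir_word p [] = []"
| "dir_word p (x # w) =
    x # (if Suc x < p then rot_word p w else if Suc x = p then dir_word p w else w)"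

definition rot :: "nat \<Rightarrow> tree_aut" where
  "rot p = Abs_tree_aut (rot_word p)"

definition dir :: "nat \<Rightarrow> tree_aut" where
  "dir p = Abs_tree_aut (dir_word p)"

lemma rot_word_facts:
  "bij (rot_word p)" "length (rot_word p v) = length v" "rot_word p (take n v) = take n (rot_word p v)"
proof -
  show "bij (rot_word p)"
  proof (rule o_bij)
    let ?h = "\<lambda>v. case v of [] \<Rightarrow> []
        | x # w \<Rightarrow> (if x < p then if x = 0 then p - 1 else x - 1 else x) # w"
    show "?h \<circ> rot_word p = id"
      by (auto simp: fun_eq_iff rot_word_def mod_Suc split: list.split)
    show "rot_word p \<circ> ?h = id"
      by (auto simp: fun_eq_iff rot_word_def split: list.split)
  qed
  show "length (rot_word p v) = length v" by (cases v) (auto simp: rot_word_def)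
  show "rot_word p (take n v) = take n (rot_word p v)"
    by (cases v; cases n) (auto simp: rot_word_def)
qed

lemma app_rot: "app (rot p) = rot_word p"
  unfolding rot_def by (intro Abs_tree_aut_facts rot_word_facts)

lemma dir_word_facts:
  "bij (dir_word p)" "length (dir_word p v) = length v" "dir_word p (take n v) = take n (dir_word p v)"
proof -
  have "dir_word p v = dir_word p w \<Longrightarrow> v = w" for v w
  proof (induction v arbitrary: w)
    case Nil
    then show ?case by (cases w) auto
  next
    case (Cons x v)
    then show ?case
      using bij_is_inj[OF rot_word_facts(1)] by (cases w) (auto split: if_splits dest: injD)
  qed
  moreover have "\<exists>w. dir_word p w = v" for v
  proof (induction v)
    case (Cons x v)
    obtain w where w: "dir_word p w = v" using Cons by blast
    obtain w' where w': "rot_word p w' = v"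
      using bij_is_surj[OF rot_word_facts(1)] by (metis surjD)
    have "dir_word p (x # (if Suc x < p then w' else if Suc x = p then w else v)) = x # v"
      using w w' by simp
    then show ?case by blast
  qed (auto intro: exI[of _ "[]"])
  ultimately show "bij (dir_word p)"
    unfolding bij_def inj_def surj_def by metis
  show "length (dir_word p v) = length v"
    by (induction v) (auto simp: rot_word_facts)
  show "dir_word p (take n v) = take n (dir_word p v)"
  proof (induction v arbitrary: n)
    case (Cons x v)
    then show ?case by (cases n) (auto simp: rot_word_facts)
  qed auto
qed

lemma app_dir: "app (dir p) = dir_word p"
  unfolding dir_def by (intro Abs_tree_aut_facts dir_word_facts)

lemma rt_rot: "rt (rot p) x = (if x < p then Suc x mod p else x)" and sec_rot [simp]: "sec (rot p) x = 1"
proof -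
  have *: "rt (rot p) x = (if x < p then Suc x mod p else x)" "app (sec (rot p) x) w = w" for x w
    using app_Cons[of "rot p" x w] by (auto simp: app_rot rot_word_def)
  show "rt (rot p) x = (if x < p then Suc x mod p else x)" by (rule *)
  show "sec (rot p) x = 1" by (rule app_eqI) (simp add: *)
qed

text \<open>The position \<open>i\<close> of the recursive entry is a parameter, so that the
  conjugates of \<open>dir p\<close> by powers of \<open>rot p\<close> have the same
  description.\<close>

definition dir_sec :: "nat \<Rightarrow> nat \<Rightarrow> nat \<Rightarrow> tree_aut" where
  "dir_sec p i x = (if x < p then if x = i then dir p else rot p else 1)"

lemma dir_branch: "0 < p \<Longrightarrow> dir p = branch (dir_sec p (p - 1))"
proof (rule app_eqI)
  fix v assume "0 < p"
  then show "app (dir p) v = app (branch (dir_sec p (p - 1))) v"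
    by (cases v) (auto simp: app_branch app_dir dir_sec_def app_rot)
qed

section \<open>The group and its affine representation\<close>

locale ggs =
  fixes p :: nat
  assumes prime_p: "Factorial_Ring.prime p" and p_ge_5: "5 \<le> p"
begin

lemma p_pos: "0 < p" and p_gt_1: "1 < p"
  using p_ge_5 by auto

section \<open>Arithmetic in the ring \<open>A\<close>\<close>

definition \<zeta> :: "int poly" where
  "\<zeta> = [:0, 1:]"

definition norm_poly :: "int poly" where
  "norm_poly = (\<Sum>i<p. \<zeta> ^ i)"

text \<open>Equality in \<open>A\<close>, kept as a congruence between integer polynomials, so that
  evaluation, coefficients and contents remain at hand.\<close>

definition cg :: "int poly \<Rightarrow> int poly \<Rightarrow> bool" (infix "\<doteq>" 50) where
  "f \<doteq> g \<longleftrightarrow> norm_poly dvd f - g"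

lemma cg_refl [simp]: "f \<doteq> f"
  by (simp add: cg_def)

lemma cg_sym: "f \<doteq> g \<Longrightarrow> g \<doteq> f"
  unfolding cg_def by (metis dvd_minus_iff minus_diff_eq)

lemma cg_trans [trans]: "f \<doteq> g \<Longrightarrow> g \<doteq> h \<Longrightarrow> f \<doteq> h"
  unfolding cg_def using dvd_add[of norm_poly "f - g" "g - h"] by simp

lemma cg_add: "f \<doteq> g \<Longrightarrow> h \<doteq> k \<Longrightarrow> f + h \<doteq> g + k"
  unfolding cg_def using dvd_add[of norm_poly "f - g" "h - k"] by (simp add: algebra_simps)

lemma cg_minus: "f \<doteq> g \<Longrightarrow> - f \<doteq> - g"
  unfolding cg_def by (metis dvd_minus_iff minus_diff_eq minus_diff_minus)

lemma cg_diff: "f \<doteq> g \<Longrightarrow> h \<doteq> k \<Longrightarrow> f - h \<doteq> g - k"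
  using cg_add[OF _ cg_minus] by fastforce

lemma cg_mult_left: "f \<doteq> g \<Longrightarrow> h * f \<doteq> h * g"
  unfolding cg_def by (metis dvd_mult right_diff_distrib)

lemma cg_mult: "f \<doteq> g \<Longrightarrow> h \<doteq> k \<Longrightarrow> f * h \<doteq> g * k"
  by (metis cg_mult_left cg_trans mult.commute)

lemma cg_sum: "(\<And>i. i \<in> A \<Longrightarrow> f i \<doteq> g i) \<Longrightarrow> sum f A \<doteq> sum g A"
  by (induction A rule: infinite_finite_induct) (auto intro: cg_add)

lemma cg_0_iff: "f - g \<doteq> 0 \<longleftrightarrow> f \<doteq> g"
  by (simp add: cg_def)

lemma zeta_minus_1: "\<zeta> - 1 \<noteq> 0"
  by (simp add: \<zeta>_def one_pCons)

lemma zeta_power_p: "\<zeta> ^ p \<doteq> 1"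
  unfolding cg_def norm_poly_def by (simp add: power_diff_1_eq)

lemma zeta_power_cg: "p dvd n \<Longrightarrow> \<zeta> ^ n \<doteq> 1"
proof -
  have "\<zeta> ^ (p * m) \<doteq> 1" for m
    by (induction m) (auto simp: power_add dest: cg_mult[OF zeta_power_p])
  then show "p dvd n \<Longrightarrow> \<zeta> ^ n \<doteq> 1" by auto
qed

text \<open>\<open>\<zeta>\<close> is a unit of \<open>A\<close>: the power
  \<open>n * (p - 1)\<close> completes \<open>n\<close> to a multiple of \<open>p\<close>.\<close>

lemma zeta_power_cancel:
  assumes "\<zeta> ^ n * f \<doteq> \<zeta> ^ n * g"
  shows "f \<doteq> g"
proof -
  define m where "m = n * (p - 1)"
  have "m + n = n * (p - 1 + 1)"
    unfolding m_def distrib_left by simp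
  then have "p dvd m + n" using p_pos by simp
  then have 1: "\<zeta> ^ m * \<zeta> ^ n * h \<doteq> h" for h
    using cg_mult[OF zeta_power_cg cg_refl, of "m + n" h] by (simp add: power_add)
  have "\<zeta> ^ m * \<zeta> ^ n * f \<doteq> \<zeta> ^ m * \<zeta> ^ n * g"
    using cg_mult_left[OF assms, of "\<zeta> ^ m"] by (simp add: mult.assoc)
  then show ?thesis by (meson 1 cg_sym cg_trans)
qed

lemma zeta_power_cong:
  assumes "m mod p = n mod p"
  shows "\<zeta> ^ m \<doteq> \<zeta> ^ n"
proof -
  have "\<zeta> ^ n \<doteq> \<zeta> ^ (n mod p)" for n
  proof -
    have "\<zeta> ^ n = \<zeta> ^ (p * (n div p)) * \<zeta> ^ (n mod p)"
      by (simp flip: power_add)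
    also have "\<dots> \<doteq> 1 * \<zeta> ^ (n mod p)"
      by (intro cg_mult zeta_power_cg) auto
    finally show ?thesis by simp
  qed
  then show ?thesis using assms by (metis cg_sym cg_trans)
qed

lemma geometric_cg_0:
  assumes "p dvd n"
  shows "(\<Sum>k<n. \<zeta> ^ k) \<doteq> 0"
proof -
  obtain m where n: "n = p * m" using assms by blast
  have "(\<zeta> - 1) * (\<Sum>k<n. \<zeta> ^ k) = (\<zeta> ^ p) ^ m - 1"
    by (simp add: n power_mult flip: power_diff_1_eq)
  also have "\<dots> = (\<zeta> - 1) * (norm_poly * (\<Sum>k<m. (\<zeta> ^ p) ^ k))"
    by (simp add: power_diff_1_eq norm_poly_def mult.assoc)
  finally have "(\<Sum>k<n. \<zeta> ^ k) = norm_poly * (\<Sum>k<m. (\<zeta> ^ p) ^ k)"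
    using zeta_minus_1 by simp
  then show ?thesis by (simp add: cg_def)
qed

section \<open>Words in the generators and their affine action\<close>

primrec ev :: "bool list \<Rightarrow> tree_aut" where
  "ev [] = 1"
| "ev (l # w) = (if l then dir p else rot p) * ev w"

primrec na :: "bool list \<Rightarrow> nat" where
  "na [] = 0"
| "na (l # w) = (if l then 0 else 1) + na w"

primrec nb :: "bool list \<Rightarrow> nat" where
  "nb [] = 0"
| "nb (l # w) = (if l then 1 else 0) + nb w"

text \<open>The image of 0 under the composite of the affine maps of the letters.\<close>

primrec Tr :: "bool list \<Rightarrow> int poly" where
  "Tr [] = 0"
| "Tr (l # w) = \<zeta> * Tr w + (if l then 1 else 0)"

text \<open>A word for the section at \<open>x\<close>. When a letter \<open>True\<close> acts, the
  letters to its right have moved \<open>x\<close> by \<open>na w\<close>; it contributes the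
  recursive letter exactly if this is the last vertex. Letters \<open>False\<close> contribute
  nothing, so all sections get words of the same length.\<close>

primrec wsec :: "bool list \<Rightarrow> nat \<Rightarrow> bool list" where
  "wsec [] x = []"
| "wsec (l # w) x = (if l then [(x + na w) mod p = p - 1] else []) @ wsec w x"

lemma ev_append: "ev (u @ v) = ev u * ev v"
  by (induction u) (simp_all add: mult.assoc)

lemma Tr_append: "Tr (u @ v) = Tr u + \<zeta> ^ length u * Tr v"
  by (induction u) (simp_all add: algebra_simps)

lemma na_nb: "na w + nb w = length w"
  by (induction w) auto

lemma length_wsec [simp]: "length (wsec w x) = nb w"
  by (induction w) auto

lemma Tr_eq_0: "nb w = 0 \<Longrightarrow> Tr w = 0"
  by (induction w) (auto split: if_splits)

lemma rt_dir [simp]: "rt (dir p) x = x"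
  using p_pos by (simp add: dir_branch)

lemma sec_dir: "sec (dir p) x = dir_sec p (p - 1) x"
  using p_pos by (simp add: dir_branch)

lemma rt_ev: "rt (ev w) x = (if x < p then (x + na w) mod p else x)"
  using p_pos by (induction w) (auto simp: rt_rot mod_Suc_eq)

lemma sec_ev: "sec (ev w) x = (if x < p then ev (wsec w x) else 1)"
  using p_pos by (induction w) (auto simp: rt_ev sec_dir dir_sec_def)

lemma na_dvd: "rt (ev w) x = x \<Longrightarrow> x < p \<Longrightarrow> p dvd na w"
proof -
  assume "rt (ev w) x = x" "x < p"
  then have "int ((x + na w) mod p) = int (x mod p)" by (simp add: rt_ev)
  then have "int (x + na w) mod int p = int x mod int p"
    by (simp only: zmod_int)
  then have "int p dvd int (x + na w) - int x"
    by (simp only: mod_eq_dvd_iff)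
  then show "p dvd na w" by simp
qed

text \<open>Each letter \<open>True\<close> of a word meets the last vertex for exactly one starting
  vertex, so it yields a letter \<open>True\<close> in exactly one section.\<close>

lemma unique_shift:
  assumes "x0 = p - 1 - r mod p" "x < p"
  shows "(x + r) mod p = p - Suc 0 \<longleftrightarrow> x = x0"
proof -
  define r' where "r' = r mod p"
  have r': "r' < p" using p_pos by (simp add: r'_def)
  have "(x + r) mod p = (x + r') mod p"
    by (simp add: r'_def mod_add_right_eq)
  also have "\<dots> = (if x + r' < p then x + r' else x + r' - p)"
  proof (cases "x + r' < p")
    case False
    then have "(x + r') mod p = (x + r' - p) mod p"
      by (intro le_mod_geq) auto
    then show ?thesis using False r' assms(2) by simp
  qed simp
  finally have eq: "(x + r) mod p = (if x + r' < p then x + r' else x + r' - p)" .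
  have x0: "x0 = p - 1 - r'" by (simp add: assms(1) r'_def)
  show ?thesis
    unfolding eq x0 using r' assms(2) by (split if_split) arith
qed

text \<open>A letter \<open>False\<close> only raises the exponent in front. A letter
  \<open>True\<close> puts one letter before every section word: the sum is multiplied by
  \<open>\<zeta>\<close> and gains \<open>\<zeta> ^ x0\<close>, which the factor in front turns into
  1, because \<open>na w + 1 + x0\<close> is a multiple of \<open>p\<close>.\<close>

lemma Tr_wsec: "Tr w \<doteq> \<zeta> ^ (na w + 1) * (\<Sum>x<p. \<zeta> ^ x * Tr (wsec w x))"
proof (induction w)
  case (Cons l w)
  let ?S = "\<lambda>w. \<Sum>x<p. \<zeta> ^ x * Tr (wsec w x)"
  have IH: "\<zeta> * Tr w \<doteq> \<zeta> * (\<zeta> ^ (na w + 1) * ?S w)"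
    using Cons by (rule cg_mult_left)
  show ?case
  proof (cases l)
    case False
    then show ?thesis using IH by (simp add: mult.assoc)
  next
    case True
    define x0 where "x0 = p - 1 - na w mod p"
    have x0: "x0 < p" using p_pos by (simp add: x0_def)
    have "?S (l # w) = \<zeta> * ?S w + (\<Sum>x<p. if x = x0 then \<zeta> ^ x else 0)"
      unfolding sum_distrib_left sum.distrib[symmetric]
      by (rule sum.cong) (auto simp: True unique_shift[OF x0_def] algebra_simps)
    then have S: "?S (l # w) = \<zeta> * ?S w + \<zeta> ^ x0"
      using x0 by simp
    have "na w mod p < p" using p_pos by simp
    then have "na w + 1 + x0 = p * (na w div p) + p"
      using p_pos mult_div_mod_eq[of p "na w"] unfolding x0_def by linarith
    then have 1: "\<zeta> ^ (na w + 1) * \<zeta> ^ x0 \<doteq> 1"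
      using zeta_power_cg[of "na w + 1 + x0"] by (simp only: power_add[symmetric]) simp
    have "Tr (l # w) \<doteq> \<zeta> * (\<zeta> ^ (na w + 1) * ?S w) + \<zeta> ^ (na w + 1) * \<zeta> ^ x0"
      using cg_add[OF IH cg_sym[OF 1]] True by simp
    also have "\<dots> = \<zeta> ^ (na (l # w) + 1) * ?S (l # w)"
      unfolding S using True by (simp add: algebra_simps)
    finally show ?thesis .
  qed
qed auto

text \<open>The same bookkeeping without weights: each letter \<open>True\<close> multiplies the sum
  by \<open>\<zeta>\<close> and adds 1.\<close>

lemma sum_Tr_wsec: "(\<Sum>x<p. Tr (wsec w x)) = (\<Sum>k<nb w. \<zeta> ^ k)"
proof (induction w)
  case (Cons l w)
  show ?case
  proof (cases l)
    case True
    define x0 where "x0 = p - 1 - na w mod p"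
    have x0: "x0 < p" using p_pos by (simp add: x0_def)
    have "(\<Sum>x<p. Tr (wsec (l # w) x)) = \<zeta> * (\<Sum>x<p. Tr (wsec w x)) + (\<Sum>x<p. if x = x0 then 1 else 0)"
      unfolding sum_distrib_left sum.distrib[symmetric]
      by (rule sum.cong) (auto simp: True unique_shift[OF x0_def] algebra_simps)
    also have "\<dots> = 1 + (\<Sum>k<nb w. \<zeta> ^ Suc k)"
      using x0 by (simp add: Cons sum_distrib_left)
    also have "\<dots> = (\<Sum>k<nb (l # w). \<zeta> ^ k)"
      using True by (simp add: sum.lessThan_Suc_shift del: sum.lessThan_Suc)
    finally show ?thesis .
  qed (use Cons in simp)
qed auto

lemma sum_nb_wsec: "(\<Sum>x<p. nb (wsec w x)) = nb w"
proof (induction w)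
  case (Cons l w)
  show ?case
  proof (cases l)
    case True
    define x0 where "x0 = p - 1 - na w mod p"
    have x0: "x0 < p" using p_pos by (simp add: x0_def)
    have "(\<Sum>x<p. nb (wsec (l # w) x)) = (\<Sum>x<p. nb (wsec w x)) + (\<Sum>x<p. if x = x0 then 1 else 0)"
      unfolding sum.distrib[symmetric]
      by (rule sum.cong) (auto simp: True unique_shift[OF x0_def])
    then show ?thesis using x0 True Cons by simp
  qed (use Cons in simp)
qed auto

text \<open>Relators act trivially. Induction on the number of letters \<open>True\<close>: sections
  of a relator are relators. If each has fewer such letters, the hypothesis applies and
  \<open>Tr_wsec\<close> carries the result up. If the section at \<open>x0\<close> keeps them all,
  the other sections are powers of \<open>rot p\<close>, which yields \<open>p dvd nb w\<close>, and
  \<open>sum_Tr_wsec\<close> settles the section at \<open>x0\<close>.\<close>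

lemma ev_eq_1:
  assumes "ev w = 1"
  shows "p dvd length w \<and> Tr w \<doteq> 0"
  using assms
proof (induction "nb w" arbitrary: w rule: less_induct)
  case less
  have na: "p dvd na w" if "ev w = 1" for w
    using na_dvd[of w 0] that p_pos by simp
  have one: "ev (wsec w x) = 1" if "x < p" for x
    using sec_ev[of w x] that less.prems by simp
  have "p dvd nb w \<and> (\<forall>x<p. Tr (wsec w x) \<doteq> 0)"
  proof (cases "\<forall>x<p. nb (wsec w x) < nb w")
    case True
    then show ?thesis
      using less.hyps[OF _ one] p_pos by (metis length_wsec)
  next
    case False
    then obtain x0 where x0: "x0 < p" "nb w \<le> nb (wsec w x0)"
      by (auto simp: not_less)
    have "(\<Sum>x<p. nb (wsec w x)) = nb (wsec w x0) + (\<Sum>x\<in>{..<p} - {x0}. nb (wsec w x))"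
      using x0 by (simp add: sum.remove)
    then have "(\<Sum>x\<in>{..<p} - {x0}. nb (wsec w x)) = 0"
      using x0 sum_nb_wsec[of w] by linarith
    then have nb0: "nb (wsec w x) = 0" if "x < p" "x \<noteq> x0" for x
      using that by simp
    then have Tr0: "Tr (wsec w x) = 0" if "x < p" "x \<noteq> x0" for x
      using that by (simp add: Tr_eq_0)
    \<comment> \<open>Any second vertex serves; its section word consists of \<open>nb w\<close>
      letters \<open>False\<close>.\<close>
    define x1 where "x1 = (if x0 = 0 then 1 else 0 :: nat)"
    have x1: "x1 < p" "x1 \<noteq> x0" using p_gt_1 by (auto simp: x1_def)
    then have dvd: "p dvd nb w"
      using na[OF one[OF x1(1)]] na_nb[of "wsec w x1"] nb0[OF x1] by simp
    have "(\<Sum>x<p. Tr (wsec w x)) = Tr (wsec w x0) + (\<Sum>x\<in>{..<p} - {x0}. Tr (wsec w x))"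
      using x0 by (simp add: sum.remove)
    also have "(\<Sum>x\<in>{..<p} - {x0}. Tr (wsec w x)) = 0"
      by (rule sum.neutral) (use Tr0 in auto)
    finally have "Tr (wsec w x0) = (\<Sum>k<nb w. \<zeta> ^ k)"
      by (simp add: sum_Tr_wsec)
    then have "Tr (wsec w x0) \<doteq> 0"
      using geometric_cg_0[OF dvd] by simp
    then show ?thesis using dvd Tr0 by (metis cg_refl)
  qed
  then have nb: "p dvd nb w" and T: "\<And>x. x < p \<Longrightarrow> Tr (wsec w x) \<doteq> 0" by auto
  have "p dvd length w"
    using nb na[OF less.prems] na_nb[of w] by (metis dvd_add)
  moreover have "\<zeta> ^ (na w + 1) * (\<Sum>x<p. \<zeta> ^ x * Tr (wsec w x)) \<doteq> \<zeta> ^ (na w + 1) * (\<Sum>x<p. \<zeta> ^ x * 0)"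
    using T by (intro cg_mult_left cg_sum) auto
  ultimately show ?case using cg_trans[OF Tr_wsec] by simp
qed

section \<open>The group, the linear part \<open>len\<close> and the translation part
  \<open>T\<close>\<close>

definition G :: "tree_aut set" where
  "G = range ev"

lemma ev_in_G [simp]: "ev w \<in> G"
  by (simp add: G_def)

lemma rot_in_G: "rot p \<in> G" and dir_in_G: "dir p \<in> G"
  using ev_in_G[of "[False]"] ev_in_G[of "[True]"] by simp_all

lemma ev_replicate: "ev (replicate n l) = (if l then dir p else rot p) ^ n"
  by (induction n) auto

lemma rot_power_p: "rot p ^ p = 1"
proof -
  have na: "na (replicate n False) = n" for n by (induction n) auto
  have wsec: "wsec (replicate n False) x = []" for n x by (induction n) auto
  have "ev (replicate p False) = 1"
    by (rule tree_aut_eqI) (auto simp: rt_ev sec_ev na wsec)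
  then show ?thesis by (simp add: ev_replicate)
qed

lemma dir_power_p: "dir p ^ p = 1"
proof -
  have "app (dir p ^ p) v = v" for v
  proof (induction v)
    case (Cons x v)
    have "dir p ^ p = branch (\<lambda>x. dir_sec p (p - 1) x ^ p)"
      using p_pos by (simp add: dir_branch branch_power)
    then have "app (dir p ^ p) (x # v) = x # app (dir_sec p (p - 1) x ^ p) v"
      by (simp add: app_branch)
    then show ?case using Cons by (auto simp: dir_sec_def rot_power_p)
  qed simp
  then show ?thesis by (intro app_eqI) simp
qed

text \<open>Words have positive letters only; inverses are reached because both generators satisfy
  \<open>x ^ p = 1\<close>.\<close>

lemma is_subgroup_G: "is_subgroup G"
proof -
  have inv: "inverse (if l then dir p else rot p) = (if l then dir p else rot p) ^ (p - 1)" for l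
  proof (rule mult_group_inverse_unique)
    have "(if l then dir p else rot p) * (if l then dir p else rot p) ^ (p - 1)
        = (if l then dir p else rot p) ^ p"
      using p_pos by (metis Suc_diff_1 power_Suc)
    then show "(if l then dir p else rot p) * (if l then dir p else rot p) ^ (p - 1) = 1"
      by (simp add: rot_power_p dir_power_p)
  qed
  have "\<exists>w'. inverse (ev w) = ev w'" for w
  proof (induction w)
    case (Cons l w)
    then obtain w' where "inverse (ev w) = ev w'" by blast
    then have "inverse (ev (l # w)) = ev (w' @ replicate (p - 1) l)"
      by (simp only: ev.simps mult_group_inverse_mult ev_append ev_replicate inv)
    then show ?case by blast
  qed (auto intro: exI[of _ "[]"])
  moreover have "1 \<in> G" using ev_in_G[of "[]"] by simp
  ultimately show ?thesis
    by (auto simp: is_subgroup_def G_def simp flip: ev_append)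
qed

lemmas G_closed = is_subgroupD[OF is_subgroup_G]

lemma ev_eq:
  assumes "ev w = ev w'"
  shows "length w mod p = length w' mod p" "Tr w \<doteq> Tr w'"
proof -
  obtain u where u: "ev u = inverse (ev w)"
    using G_closed(3)[OF ev_in_G[of w]] by (auto simp: G_def)
  have "ev (u @ w) = 1" "ev (u @ w') = 1"
    by (simp_all add: ev_append u assms)
  then have 1: "p dvd length u + length w" "p dvd length u + length w'"
      "Tr u + \<zeta> ^ length u * Tr w \<doteq> 0" "Tr u + \<zeta> ^ length u * Tr w' \<doteq> 0"
    by (auto dest!: ev_eq_1 simp: Tr_append)
  have "int p dvd (int (length u + length w) - int (length u + length w'))"
    using 1(1,2) by (intro dvd_diff) (simp_all only: int_dvd_int_iff)
  then have "int (length w) mod int p = int (length w') mod int p"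
    by (simp add: mod_eq_dvd_iff)
  then show "length w mod p = length w' mod p"
    by (simp flip: zmod_int)
  have "\<zeta> ^ length u * Tr w \<doteq> \<zeta> ^ length u * Tr w'"
  proof -
    have "\<zeta> ^ length u * Tr w - \<zeta> ^ length u * Tr w' \<doteq> 0"
      using cg_diff[OF 1(3,4)] by simp
    then show ?thesis by (simp only: cg_0_iff)
  qed
  then show "Tr w \<doteq> Tr w'" by (rule zeta_power_cancel)
qed

text \<open>An arbitrary representing word. By \<open>ev_eq\<close>, for elements of
  \<open>G\<close> the resulting \<open>len\<close> is meaningful modulo \<open>p\<close> and
  \<open>T\<close> modulo \<open>norm_poly\<close>, so statements about them are
  congruences.\<close>

definition word_of :: "tree_aut \<Rightarrow> bool list" where
  "word_of g = (SOME w. ev w = g)"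

definition len :: "tree_aut \<Rightarrow> nat" where
  "len g = length (word_of g)"

definition T :: "tree_aut \<Rightarrow> int poly" where
  "T g = Tr (word_of g)"

lemma ev_word_of: "g \<in> G \<Longrightarrow> ev (word_of g) = g"
  unfolding word_of_def by (rule someI_ex) (auto simp: G_def)

lemma len_ev: "len (ev w) mod p = length w mod p" and T_ev: "T (ev w) \<doteq> Tr w"
  unfolding len_def T_def using ev_eq[OF ev_word_of[OF ev_in_G]] by auto

lemma len_mult: "g \<in> G \<Longrightarrow> h \<in> G \<Longrightarrow> len (g * h) mod p = (len g + len h) mod p"
  using len_ev[of "word_of g @ word_of h"] by (simp add: ev_append ev_word_of len_def)

lemma T_mult: "g \<in> G \<Longrightarrow> h \<in> G \<Longrightarrow> T (g * h) \<doteq> T g + \<zeta> ^ len g * T h"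
  using T_ev[of "word_of g @ word_of h"] by (simp add: ev_append ev_word_of len_def T_def Tr_append)

lemma T_one: "T 1 \<doteq> 0" and len_one: "len 1 mod p = 0"
  using T_ev[of "[]"] len_ev[of "[]"] by simp_all

definition K :: "tree_aut set" where
  "K = {g \<in> G. p dvd len g}"

lemma K_G: "g \<in> K \<Longrightarrow> g \<in> G"
  by (simp add: K_def)

lemma ev_in_K: "ev w \<in> K \<longleftrightarrow> p dvd length w"
  using len_ev[of w] by (simp add: K_def dvd_eq_mod_eq_0)

lemma T_mult_K:
  assumes "g \<in> K" "h \<in> G"
  shows "T (g * h) \<doteq> T g + T h"
proof -
  have "T (g * h) \<doteq> T g + \<zeta> ^ len g * T h"
    using assms by (intro T_mult) (auto simp: K_def)
  also have "T g + \<zeta> ^ len g * T h \<doteq> T g + 1 * T h"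
    using assms by (intro cg_add cg_mult zeta_power_cg) (auto simp: K_def)
  finally show ?thesis by simp
qed

lemma len_inverse: "g \<in> G \<Longrightarrow> p dvd len g + len (inverse g)"
  using len_mult[of g "inverse g"] len_one by (simp add: G_closed dvd_eq_mod_eq_0)

lemma is_normal_K: "is_normal K G"
  unfolding is_normal_def is_subgroup_def
proof (intro conjI ballI)
  show "K \<subseteq> G" by (auto simp: K_def)
  show "1 \<in> K" using ev_in_K[of "[]"] by simp
  show "g * h \<in> K" if "g \<in> K" "h \<in> K" for g h
    using that len_mult[of g h] by (auto simp: K_def G_closed dvd_eq_mod_eq_0 mod_add_eq)
  show "inverse g \<in> K" if "g \<in> K" for g
    using that len_inverse[of g] by (auto simp: K_def G_closed dvd_add_right_iff)
  show "g * h * inverse g \<in> K" if "g \<in> G" "h \<in> K" for g h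
  proof -
    have "len (g * h * inverse g) mod p = (len g + len h + len (inverse g)) mod p"
      using that len_mult[of "g * h" "inverse g"] mod_add_cong[OF len_mult[of g h] refl]
      by (simp add: K_G G_closed)
    also have "p dvd len g + len h + len (inverse g)"
    proof -
      have "p dvd (len g + len (inverse g)) + len h"
        using len_inverse[OF that(1)] that(2) by (simp add: K_def)
      then show ?thesis by (simp add: algebra_simps)
    qed
    then have "(len g + len h + len (inverse g)) mod p = 0" by simp
    finally show ?thesis using that by (auto simp: K_def G_closed)
  qed
qed

lemmas K_closed = is_subgroupD[OF is_normalD(2)[OF is_normal_K]]

lemma T_inverse_K:
  assumes "g \<in> K"
  shows "T (inverse g) \<doteq> - T g"
proof -
  have "T g + T (inverse g) \<doteq> T (g * inverse g)"
    using assms by (intro cg_sym[OF T_mult_K]) (auto simp: K_closed K_G)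
  also have "\<dots> \<doteq> 0" using T_one by simp
  finally have "T (inverse g) - - T g \<doteq> 0" by (simp add: add.commute)
  then show ?thesis by (simp only: cg_0_iff)
qed

lemma T_conj:
  assumes "g \<in> G" "h \<in> K"
  shows "T (g * h * inverse g) \<doteq> \<zeta> ^ len g * T h"
proof -
  define k where "k = g * h * inverse g"
  have k: "k \<in> K" using is_normalD(3)[OF is_normal_K] assms by (simp add: k_def)
  have "g * h = k * g" by (simp add: k_def mult.assoc)
  then have "T g + \<zeta> ^ len g * T h \<doteq> T k + T g"
    using T_mult[OF assms(1) K_G[OF assms(2)]] T_mult_K[OF k assms(1)] by (metis cg_sym cg_trans)
  then have "T g + \<zeta> ^ len g * T h - T g \<doteq> T k + T g - T g"
    by (intro cg_diff) auto
  then show ?thesis by (simp add: k_def cg_sym)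
qed

lemma T_power_K: "g \<in> K \<Longrightarrow> T (g ^ n) \<doteq> of_nat n * T g"
proof (induction n)
  case (Suc n)
  have "T (g * g ^ n) \<doteq> T g + T (g ^ n)"
    using Suc by (intro T_mult_K) (auto simp: K_closed K_G)
  also have "\<dots> \<doteq> T g + of_nat n * T g"
    using Suc by (intro cg_add) auto
  finally show ?case by (simp add: algebra_simps)
qed (use T_one in auto)

lemma sec_in_G: "g \<in> G \<Longrightarrow> x < p \<Longrightarrow> sec g x \<in> G"
  and sec_eq_1: "g \<in> G \<Longrightarrow> p \<le> x \<Longrightarrow> sec g x = 1"
  by (auto simp: G_def sec_ev)

lemma rt_G: "g \<in> G \<Longrightarrow> p \<le> x \<Longrightarrow> rt g x = x"
  by (auto simp: G_def rt_ev)

text \<open>If \<open>g\<close> fixes one first-level vertex, then \<open>p\<close> divides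
  \<open>na w\<close> for a word \<open>w\<close> of \<open>g\<close>. All sections have words of
  length \<open>nb w\<close>, so they lie in \<open>K\<close> exactly if \<open>g\<close> does. The
  weighted and the unweighted sum of section values are the two linear equations that govern the
  sections of elements of \<open>R\<close>.\<close>

lemma level_one:
  assumes "g \<in> G" "rt g x = x" "x < p"
  shows "rt g y = y" "branch (sec g) = g"
    "T g \<doteq> \<zeta> * (\<Sum>y<p. \<zeta> ^ y * T (sec g y))"
    "y < p \<Longrightarrow> sec g y \<in> K \<longleftrightarrow> g \<in> K"
    "g \<in> K \<Longrightarrow> (\<Sum>y<p. T (sec g y)) \<doteq> 0"
proof -
  obtain w where w: "g = ev w" using assms(1) by (auto simp: G_def)
  have na: "p dvd na w"
    using assms w na_dvd by metis
  show rt: "rt g y = y" for y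
    using na by (auto simp: w rt_ev elim!: dvdE)
  show "branch (sec g) = g" by (rule branch_sec) (rule rt)
  have T: "T (sec g y) \<doteq> Tr (wsec w y)" if "y < p" for y
    using T_ev that by (simp add: w sec_ev)
  have "T g \<doteq> \<zeta> ^ (na w + 1) * (\<Sum>y<p. \<zeta> ^ y * Tr (wsec w y))"
    unfolding w by (rule cg_trans[OF T_ev Tr_wsec])
  also have "\<dots> \<doteq> (1 * \<zeta>) * (\<Sum>y<p. \<zeta> ^ y * T (sec g y))"
    unfolding power_add power_one_right
    by (intro cg_mult cg_sum zeta_power_cg na cg_refl cg_sym[OF T]) auto
  finally show "T g \<doteq> \<zeta> * (\<Sum>y<p. \<zeta> ^ y * T (sec g y))" by simp
  have K: "g \<in> K \<longleftrightarrow> p dvd nb w"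
    using na na_nb[of w] by (metis dvd_add_right_iff ev_in_K w)
  show "sec g y \<in> K \<longleftrightarrow> g \<in> K" if "y < p"
    using that unfolding K by (simp add: w sec_ev ev_in_K)
  show "(\<Sum>y<p. T (sec g y)) \<doteq> 0" if "g \<in> K"
  proof -
    have "(\<Sum>y<p. T (sec g y)) \<doteq> (\<Sum>y<p. Tr (wsec w y))"
      by (intro cg_sum T) auto
    then show ?thesis
      using that K geometric_cg_0 sum_Tr_wsec cg_trans by metis
  qed
qed

section \<open>The subgroup \<open>R\<close> and generators of \<open>K\<close>\<close>

definition R :: "tree_aut set" where
  "R = {g \<in> K. T g \<doteq> 0}"

lemma R_K: "g \<in> R \<Longrightarrow> g \<in> K" and R_G: "g \<in> R \<Longrightarrow> g \<in> G"
  by (auto simp: R_def K_G)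

lemma is_normal_R: "is_normal R G"
  unfolding is_normal_def is_subgroup_def
proof (intro conjI ballI)
  show "R \<subseteq> G" by (auto simp: R_G)
  show "1 \<in> R" using T_one K_closed by (simp add: R_def)
  show "g * h \<in> R" if "g \<in> R" "h \<in> R" for g h
    using that cg_trans[OF T_mult_K[of g h] cg_add[of "T g" 0 "T h" 0]]
    by (auto simp: R_def K_closed K_G)
  show "inverse g \<in> R" if "g \<in> R" for g
    using that cg_trans[OF T_inverse_K[of g] cg_minus[of "T g" 0]] by (auto simp: R_def K_closed)
  show "g * h * inverse g \<in> R" if "g \<in> G" "h \<in> R" for g h
    using that cg_trans[OF T_conj[of g h] cg_mult_left[of "T h" 0 "\<zeta> ^ len g"]]
      is_normalD(3)[OF is_normal_K]
    by (auto simp: R_def)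
qed

lemmas R_closed = is_subgroupD[OF is_normalD(2)[OF is_normal_R]]

lemma T_quotient_K:
  assumes "g \<in> K" "h \<in> K"
  shows "T (inverse g * h) \<doteq> T h - T g"
proof -
  have "T (inverse g * h) \<doteq> T (inverse g) + T h"
    using assms by (intro T_mult_K) (auto simp: K_closed K_G)
  also have "\<dots> \<doteq> - T g + T h"
    using assms by (intro cg_add T_inverse_K) auto
  finally show ?thesis by simp
qed

lemma quotient_in_R:
  assumes "g \<in> K" "h \<in> K" "T g \<doteq> T h"
  shows "inverse g * h \<in> R"
proof -
  have "T h - T g \<doteq> 0" using assms(3) by (simp add: cg_0_iff cg_sym)
  then show ?thesis
    using cg_trans[OF T_quotient_K[OF assms(1,2)]] assms by (simp add: R_def K_closed)
qed

definition gen :: tree_aut where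
  "gen = dir p * inverse (rot p)"

lemma gen_in_K: "gen \<in> K" and T_gen: "T gen \<doteq> 1"
proof -
  have "inverse (rot p) = rot p ^ (p - 1)"
    using rot_power_p p_pos
    by (intro mult_group_inverse_unique) (metis Suc_diff_1 power_Suc)
  then have gen: "gen = ev (True # replicate (p - 1) False)"
    by (simp add: gen_def ev_replicate)
  have Tr0: "Tr (replicate n False) = 0" for n by (induction n) auto
  show "gen \<in> K" using p_pos unfolding gen ev_in_K by simp
  show "T gen \<doteq> 1"
    unfolding gen using T_ev[of "True # replicate (p - 1) False"] by (simp add: Tr0)
qed

text \<open>Up to a power of \<open>rot p\<close>, a word is a product of conjugates of
  \<open>gen\<close>; that power is trivial when the length is a multiple of \<open>p\<close>. So
  the conjugates of \<open>gen\<close> generate \<open>K\<close>.\<close>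

lemma K_induct [consumes 1, case_names one gen mult rot dir]:
  assumes "g \<in> K"
    and one: "P 1" and gen: "P gen" and mult: "\<And>g h. g \<in> K \<Longrightarrow> h \<in> K \<Longrightarrow> P g \<Longrightarrow> P h \<Longrightarrow> P (g * h)"
    and rot: "\<And>g. g \<in> K \<Longrightarrow> P g \<Longrightarrow> P (rot p * g * inverse (rot p))"
    and dir: "\<And>g. g \<in> K \<Longrightarrow> P g \<Longrightarrow> P (dir p * g * inverse (dir p))"
  shows "P g"
proof -
  let ?r = "inverse (rot p)"
  have main: "ev w * ?r ^ length w \<in> K \<and> P (ev w * ?r ^ length w)" for w
  proof (induction w)
    case (Cons l w)
    define L where "L = (if l then dir p else rot p)"
    define e where "e = ev w * ?r ^ length w"
    have L: "L \<in> G" by (simp add: L_def rot_in_G dir_in_G)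
    have K1: "L * e * inverse L \<in> K"
      using is_normalD(3)[OF is_normal_K L] Cons by (simp add: e_def)
    have P1: "P (L * e * inverse L)"
      using Cons rot dir by (simp add: e_def L_def)
    have "L * ?r \<in> K \<and> P (L * ?r)"
      using one gen gen_in_K K_closed by (simp add: L_def gen_def)
    moreover have "ev (l # w) * ?r ^ length (l # w) = (L * e * inverse L) * (L * ?r)"
      by (simp add: L_def e_def mult.assoc power_commutes)
    ultimately show ?case using K1 P1 mult K_closed by metis
  qed (use one K_closed in auto)
  obtain w where w: "g = ev w" using K_G[OF assms(1)] by (auto simp: G_def)
  then obtain m where "length w = p * m" using assms(1) by (auto simp: ev_in_K)
  moreover have "?r ^ p = 1"
    by (simp add: mult_group_power_inverse rot_power_p)
  ultimately show ?thesis
    using main[of w] by (simp add: w power_mult)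
qed


section \<open>Elements with prescribed first-level sections\<close>

definition cdir :: "nat \<Rightarrow> tree_aut" where
  "cdir i = branch (dir_sec p i)"

text \<open>Conjugation by \<open>rot p\<close> moves the recursive entry to the next vertex, so
  these are the conjugates of \<open>dir p\<close> by powers of \<open>rot p\<close>.\<close>

lemma cdir_in_G:
  assumes "i < p"
  shows "cdir i \<in> G"
proof -
  have conj: "rot p * cdir i * inverse (rot p) = cdir (Suc i mod p)" if "i < p" for i
  proof -
    have "rot p * cdir i = cdir (Suc i mod p) * rot p"
    proof (rule tree_aut_eqI)
      show "rt (rot p * cdir i) x = rt (cdir (Suc i mod p) * rot p) x" for x
        by (simp add: cdir_def)
      show "sec (rot p * cdir i) x = sec (cdir (Suc i mod p) * rot p) x" for x
        using that by (auto simp: cdir_def rt_rot dir_sec_def mod_Suc)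
    qed
    then show ?thesis by (simp add: mult.assoc)
  qed
  have "cdir ((p - 1 + n) mod p) \<in> G" for n
  proof (induction n)
    case 0
    have "cdir (p - 1) = dir p" using p_pos by (simp add: cdir_def dir_branch)
    then show ?case using p_pos dir_in_G by simp
  next
    case (Suc n)
    have "cdir (Suc ((p - 1 + n) mod p) mod p) \<in> G"
      using Suc p_pos conj[of "(p - 1 + n) mod p"] rot_in_G by (metis G_closed(2,3) mod_less_divisor)
    then show ?case by (simp add: mod_Suc_eq)
  qed
  \<comment> \<open>Starting at \<open>p - 1\<close>, exactly \<open>Suc i\<close> shifts lead to
    \<open>i\<close>.\<close>
  from this[of "Suc i"] show ?thesis
    using assms by simp
qed

text \<open>At \<open>i\<close> the section of \<open>cdir i\<close> is \<open>dir p\<close> and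
  that of \<open>cdir j\<close> is \<open>rot p\<close>, so a word is lifted letter by
  letter.\<close>

lemma fractal:
  assumes "g \<in> G" "i < p"
  shows "\<exists>f. branch f \<in> G \<and> f i = g"
proof -
  define j where "j = (if i = 0 then 1 else 0 :: nat)"
  have j: "j < p" "j \<noteq> i" using p_gt_1 by (auto simp: j_def)
  have "\<exists>f. branch f \<in> G \<and> f i = ev w" for w
  proof (induction w)
    case Nil
    show ?case using G_closed(1) by (intro exI[of _ "\<lambda>_. 1"]) (simp add: branch_one)
  next
    case (Cons l w)
    then obtain f where f: "branch f \<in> G" "f i = ev w" by blast
    have "cdir (if l then i else j) * branch f \<in> G"
      using f j assms by (intro G_closed cdir_in_G) auto
    moreover have "dir_sec p (if l then i else j) i * f i = ev (l # w)"
      using f j assms by (simp add: dir_sec_def)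
    ultimately show ?case
      by (intro exI[of _ "\<lambda>x. dir_sec p (if l then i else j) x * f x"])
        (simp add: cdir_def branch_mult)
  qed
  then show ?thesis using assms by (auto simp: G_def)
qed

definition pair :: "nat \<Rightarrow> nat \<Rightarrow> tree_aut \<Rightarrow> tree_aut \<Rightarrow> nat \<Rightarrow> tree_aut" where
  "pair i j k k' = (\<lambda>_. 1)(i := k, j := k')"

text \<open>In \<open>cdir i * inverse (cdir j)\<close> the entries away from \<open>i\<close> and
  \<open>j\<close> cancel and \<open>gen\<close> stands at \<open>i\<close>. Conjugating by
  \<open>cdir j\<close> or \<open>cdir i\<close> applies \<open>rot p\<close> or
  \<open>dir p\<close> at \<open>i\<close> and keeps the trivial entries trivial, so
  \<open>K_induct\<close> reaches all of \<open>K\<close>. The entry at \<open>j\<close> is not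
  prescribed.\<close>

lemma pair_exists:
  assumes "k \<in> K" "i < p" "j < p" "i \<noteq> j"
  shows "\<exists>k'. branch (pair i j k k') \<in> G"
  using assms(1)
proof (induction rule: K_induct)
  case one
  show ?case using G_closed(1)
    by (intro exI[of _ 1]) (simp add: pair_def branch_one fun_upd_idem)
next
  case gen
  have "cdir i * inverse (cdir j) \<in> G"
    using assms by (intro G_closed cdir_in_G)
  moreover have "cdir i * inverse (cdir j) = branch (pair i j gen (rot p * inverse (dir p)))"
    using assms by (auto simp: cdir_def branch_inverse branch_mult pair_def dir_sec_def gen_def fun_eq_iff)
  ultimately show ?case by metis
next
  case (mult g h)
  then obtain g' h' where "branch (pair i j g g') \<in> G" "branch (pair i j h h') \<in> G" by blast
  then have "branch (pair i j g g') * branch (pair i j h h') \<in> G" by (intro G_closed)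
  moreover have "branch (pair i j g g') * branch (pair i j h h') = branch (pair i j (g * h) (g' * h'))"
    by (auto simp: branch_mult pair_def fun_eq_iff)
  ultimately show ?case by metis
next
  case (rot g)
  then obtain g' where "branch (pair i j g g') \<in> G" by blast
  then have "cdir j * branch (pair i j g g') * inverse (cdir j) \<in> G"
    using assms by (intro G_closed cdir_in_G)
  moreover have "cdir j * branch (pair i j g g') * inverse (cdir j)
      = branch (pair i j (rot p * g * inverse (rot p)) (dir p * g' * inverse (dir p)))"
    using assms by (auto simp: cdir_def branch_mult branch_inverse pair_def dir_sec_def fun_eq_iff)
  ultimately show ?case by metis
next
  case (dir g)
  then obtain g' where "branch (pair i j g g') \<in> G" by blast
  then have "cdir i * branch (pair i j g g') * inverse (cdir i) \<in> G"
    using assms by (intro G_closed cdir_in_G)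
  moreover have "cdir i * branch (pair i j g g') * inverse (cdir i)
      = branch (pair i j (dir p * g * inverse (dir p)) (rot p * g' * inverse (rot p)))"
    using assms by (auto simp: cdir_def branch_mult branch_inverse pair_def dir_sec_def fun_eq_iff)
  ultimately show ?case by metis
qed

lemma branch_level_one:
  assumes "branch f \<in> G" "x < p" "f x \<in> K"
  shows "branch f \<in> K" "T (branch f) \<doteq> \<zeta> * (\<Sum>y<p. \<zeta> ^ y * T (f y))"
    "(\<Sum>y<p. T (f y)) \<doteq> 0" "y < p \<Longrightarrow> f y \<in> K"
proof -
  note l = level_one[OF assms(1) rt_branch assms(2), unfolded sec_branch]
  show K: "branch f \<in> K" using l(4)[OF assms(2)] assms(3) by simp
  show "T (branch f) \<doteq> \<zeta> * (\<Sum>y<p. \<zeta> ^ y * T (f y))" by (rule l(3))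
  show "(\<Sum>y<p. T (f y)) \<doteq> 0" by (rule l(5)[OF K])
  show "y < p \<Longrightarrow> f y \<in> K" using l(4) K by simp
qed

lemma T_branch_pair:
  assumes "branch (pair i j k k') \<in> G" "k \<in> K" "i < p" "j < p" "i \<noteq> j"
  shows "branch (pair i j k k') \<in> K" "k' \<in> K" "T k' \<doteq> - T k"
    "T (branch (pair i j k k')) \<doteq> \<zeta> * (\<zeta> ^ i - \<zeta> ^ j) * T k"
proof -
  have i: "pair i j k k' i \<in> K" using assms by (simp add: pair_def)
  note l = branch_level_one[OF assms(1,3) i]
  show "branch (pair i j k k') \<in> K" by (rule l)
  show "k' \<in> K" using l(4)[OF assms(4)] by (simp add: pair_def)
  have two: "(\<Sum>y<p. c y * T (pair i j k k' y)) \<doteq> c i * T k + c j * T k'" for c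
  proof -
    have "(\<Sum>y<p. c y * T (pair i j k k' y))
        \<doteq> (\<Sum>y<p. (if y = i then c i * T k else 0) + (if y = j then c j * T k' else 0))"
      using assms(5) cg_mult_left[OF T_one] by (intro cg_sum) (auto simp: pair_def)
    also have "\<dots> = c i * T k + c j * T k'"
      using assms by (simp add: sum.distrib)
    finally show ?thesis .
  qed
  have "T k + T k' \<doteq> 0"
    using cg_trans[OF cg_sym[OF two[of "\<lambda>_. 1"]], of 0] l(3) by simp
  then have "T k' - - T k \<doteq> 0" by (simp add: add.commute)
  then show neg: "T k' \<doteq> - T k" by (simp only: cg_0_iff)
  have "T (branch (pair i j k k')) \<doteq> \<zeta> * (\<Sum>y<p. \<zeta> ^ y * T (pair i j k k' y))"
    by (rule l)
  also have "\<dots> \<doteq> \<zeta> * (\<zeta> ^ i * T k + \<zeta> ^ j * T k')"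
    by (intro cg_mult_left two)
  also have "\<dots> \<doteq> \<zeta> * (\<zeta> ^ i * T k + \<zeta> ^ j * (- T k))"
    by (intro cg_mult cg_add cg_refl neg)
  finally show "T (branch (pair i j k k')) \<doteq> \<zeta> * (\<zeta> ^ i - \<zeta> ^ j) * T k"
    by (simp add: algebra_simps)
qed

text \<open>Horner's scheme: powers of \<open>gen\<close> give the integer constants, and
  conjugation by \<open>rot p\<close> multiplies by \<open>\<zeta>\<close>.\<close>

lemma T_surj: "\<exists>k\<in>K. T k \<doteq> f"
proof -
  have const: "\<exists>k\<in>K. T k \<doteq> of_int c" for c
  proof (cases c rule: int_cases)
    case (nonneg n)
    have "T (gen ^ n) \<doteq> of_nat n * 1"
      by (rule cg_trans[OF T_power_K[OF gen_in_K] cg_mult_left[OF T_gen]])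
    then show ?thesis
      using K_closed(4)[OF gen_in_K, of n] by (auto simp: nonneg)
  next
    case (neg n)
    have "T (inverse (gen ^ Suc n)) \<doteq> - T (gen ^ Suc n)"
      by (intro T_inverse_K K_closed gen_in_K)
    also have "\<dots> \<doteq> - (of_nat (Suc n) * 1)"
      by (intro cg_minus cg_trans[OF T_power_K[OF gen_in_K] cg_mult_left[OF T_gen]])
    finally have "T (inverse (gen ^ Suc n)) \<doteq> of_int c" by (simp add: neg)
    then show ?thesis using K_closed(3)[OF K_closed(4)[OF gen_in_K]] by blast
  qed
  have len_rot: "len (rot p) mod p = 1"
    using len_ev[of "[False]"] p_gt_1 by simp
  show ?thesis
  proof (induction f)
    case 0
    then show ?case using T_one K_closed by blast
  next
    case (pCons c f)
    then obtain k k' where k: "k \<in> K" "T k \<doteq> f" and k': "k' \<in> K" "T k' \<doteq> of_int c"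
      using const by blast
    have K: "rot p * k * inverse (rot p) \<in> K"
      using is_normalD(3)[OF is_normal_K rot_in_G] k by simp
    have "T (rot p * k * inverse (rot p)) \<doteq> \<zeta> ^ len (rot p) * T k"
      using k by (intro T_conj rot_in_G)
    also have "\<dots> \<doteq> \<zeta> ^ 1 * f"
      using k len_rot p_gt_1 by (intro cg_mult zeta_power_cong) auto
    finally have "T k' + T (rot p * k * inverse (rot p)) \<doteq> of_int c + \<zeta> * f"
      using k' by (intro cg_add) auto
    then have "T (k' * (rot p * k * inverse (rot p))) \<doteq> of_int c + \<zeta> * f"
      using T_mult_K[OF k'(1) K_G[OF K]] cg_trans by blast
    moreover have "of_int c + \<zeta> * f = pCons c f"
      by (simp add: \<zeta>_def of_int_poly)
    ultimately show ?case using K_closed(2)[OF k'(1) K] by metis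
  qed
qed

text \<open>The inner binomial coefficients are divisible by \<open>p\<close>; as \<open>p\<close>
  is odd, the outer terms give \<open>\<zeta> ^ p - 1\<close>, which vanishes in
  \<open>A\<close>.\<close>

lemma zeta_minus_1_power_p: "\<exists>h. (\<zeta> - 1) ^ p \<doteq> of_nat p * h"
proof -
  define t where "t k = of_nat (p choose k) * \<zeta> ^ k * (- 1) ^ (p - k)" for k
  have "(\<zeta> - 1) ^ p = (\<Sum>k\<le>p. t k)"
    using binomial_ring[of \<zeta> "- 1" p] by (simp add: t_def)
  also have "{..p} = insert 0 (insert p {1..<p})"
    using p_pos by auto
  also have "sum t \<dots> = t 0 + (t p + (\<Sum>k=1..<p. t k))"
    using p_pos by simp
  also have "t p = \<zeta> ^ p" by (simp add: t_def)
  also have "t 0 = - 1"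
    using prime_odd_nat[OF prime_p] p_ge_5 by (simp add: t_def)
  finally have eq: "(\<zeta> - 1) ^ p = (\<Sum>k=1..<p. t k) + (\<zeta> ^ p - 1)" by simp
  have "of_nat p dvd (\<Sum>k=1..<p. t k)"
  proof (rule dvd_sum)
    fix k assume "k \<in> {1..<p}"
    then have "p dvd (p choose k)"
      using p_pos by (intro dvd_choose_prime prime_p) auto
    then have "of_nat p dvd (of_nat (p choose k) :: int poly)"
      by (auto elim!: dvdE)
    then show "of_nat p dvd t k"
      unfolding t_def by (intro dvd_mult2)
  qed
  then obtain h where h: "(\<Sum>k=1..<p. t k) = of_nat p * h" by blast
  have "\<zeta> ^ p - 1 \<doteq> 0" by (simp only: cg_0_iff zeta_power_p)
  then have "(\<zeta> - 1) ^ p \<doteq> of_nat p * h + 0"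
    unfolding eq h by (intro cg_add cg_refl)
  then show ?thesis by auto
qed

text \<open>\<open>A\<close> is torsion-free by Gauss's lemma: \<open>norm_poly\<close> has constant
  coefficient 1, hence content 1, so an integer dividing \<open>norm_poly * q\<close> divides
  \<open>q\<close>.\<close>

lemma of_nat_cg_0:
  assumes "of_nat n * f \<doteq> 0" "0 < n"
  shows "f \<doteq> 0"
proof -
  have const: "(of_nat n :: int poly) = [:int n:]"
    by (simp add: of_nat_poly)
  obtain q where q: "[:int n:] * f = norm_poly * q"
    using assms(1) by (auto simp: cg_def const)
  have "Polynomial.coeff norm_poly 0 = 1"
  proof -
    have "Polynomial.coeff (\<zeta> ^ i) 0 = (if i = 0 then 1 else 0)" for i
      by (cases i) (simp_all add: \<zeta>_def)
    then show ?thesis using p_pos by (simp add: norm_poly_def Polynomial.coeff_sum)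
  qed
  then have "is_unit (content norm_poly)"
    using content_dvd_coeff[of norm_poly 0] by simp
  then have "normalize (content norm_poly) = 1" by (rule is_unit_normalize)
  then have "content norm_poly = 1" by (simp only: normalize_content)
  moreover have "int n dvd content (norm_poly * q)"
    unfolding q[symmetric] by (simp flip: const_poly_dvd_iff_dvd_content)
  ultimately have "[:int n:] dvd q"
    by (simp add: content_mult const_poly_dvd_iff_dvd_content)
  then obtain r where "q = [:int n:] * r" by blast
  then have "[:int n:] * f = [:int n:] * (norm_poly * r)"
    using q by (simp add: ac_simps)
  then have "f = norm_poly * r"
    using assms(2) by (simp only: mult_cancel_left) auto
  then show ?thesis by (simp add: cg_def)
qed

section \<open>Level stabilizers\<close>

definition St :: "nat \<Rightarrow> tree_aut set" where
  "St n = {g \<in> G. \<forall>v\<in>vertices p. length v = n \<longrightarrow> app g v = v}"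

lemma St_G: "g \<in> St n \<Longrightarrow> g \<in> G"
  by (simp add: St_def)

lemma replicate_0_vertices: "replicate n 0 \<in> vertices p"
  using p_pos by (induction n) auto

lemma St_sec:
  assumes "g \<in> St (Suc n)" "x < p"
  shows "rt g x = x" "sec g x \<in> St n"
proof -
  have *: "rt g x = x \<and> app (sec g x) v = v" if "v \<in> vertices p" "length v = n" for v
    using assms that app_Cons[of g x v] by (auto simp: St_def)
  show "rt g x = x" using *[OF replicate_0_vertices] by simp
  show "sec g x \<in> St n" using * assms sec_in_G by (auto simp: St_def)
qed

lemma St_mono:
  assumes "m \<le> n"
  shows "St n \<subseteq> St m"
proof
  fix g assume g: "g \<in> St n"
  have "app g v = v" if v: "v \<in> vertices p" "length v = m" for v
  proof -
    let ?u = "v @ replicate (n - m) 0"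
    have "?u \<in> vertices p"
      using v replicate_0_vertices by (simp add: vertices_def)
    then have "app g ?u = ?u" using g v assms by (simp add: St_def)
    then show ?thesis using app_facts(3)[of g m ?u] v by simp
  qed
  then show "g \<in> St m" using g by (simp add: St_def)
qed

lemma is_subgroup_St: "is_subgroup (St n)"
proof -
  have "app (inverse g) v = v" if "app g v = v" for g v
    by (metis app_mult app_one mult_group_left_inverse that)
  then show ?thesis by (auto simp: is_subgroup_def St_def G_closed)
qed

text \<open>\<open>g ^ p\<close> fixes the first level, and its sections again lie in
  \<open>G\<close>; each level costs one more factor \<open>p\<close> in the exponent.\<close>

lemma power_in_St: "g \<in> G \<Longrightarrow> g ^ p ^ n \<in> St n"
proof (induction n arbitrary: g)
  case (Suc n)
  obtain w where w: "g = ev w" using Suc.prems by (auto simp: G_def)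
  have "rt (g ^ m) x = (x + m * na w) mod p" if "x < p" for m x
    using that p_pos by (induction m) (auto simp: w rt_ev mod_simps algebra_simps)
  then have "rt (g ^ p) 0 = 0" using p_pos by simp
  then have b: "branch (sec (g ^ p)) = g ^ p"
    using level_one(2)[of "g ^ p" 0] Suc.prems p_pos by (simp add: G_closed)
  have "app (g ^ p ^ Suc n) v = v" if v: "v \<in> vertices p" "length v = Suc n" for v
  proof -
    obtain x u where u: "v = x # u" using v by (cases v) auto
    then have x: "x < p" "u \<in> vertices p" "length u = n" using v by auto
    have "sec (g ^ p) x ^ p ^ n \<in> St n"
      using Suc x sec_in_G by (simp add: G_closed)
    then have "app (sec (g ^ p) x ^ p ^ n) u = u" using x by (simp add: St_def)
    moreover have "g ^ p ^ Suc n = branch (\<lambda>x. sec (g ^ p) x ^ p ^ n)"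
      by (simp add: power_mult b flip: branch_power)
    ultimately show ?thesis by (simp add: u app_branch)
  qed
  then show ?case using Suc.prems by (simp add: St_def G_closed)
qed (simp add: St_def)

text \<open>Fixing the second level makes \<open>p\<close> divide \<open>na\<close> of
  \<open>w\<close> and of each section word. The section words have total length
  \<open>p * nb w\<close> and contain \<open>nb w\<close> letters \<open>True\<close> in all, so
  \<open>p\<close> divides \<open>nb w\<close> too.\<close>

lemma St_2_K:
  assumes "g \<in> St (Suc (Suc 0))"
  shows "g \<in> K"
proof -
  obtain w where w: "g = ev w" using St_G[OF assms] by (auto simp: G_def)
  have "p dvd na w"
    using St_sec(1)[OF assms] p_pos w na_dvd by metis
  have "rt (ev (wsec w y)) 0 = 0" if "y < p" for y
    using St_sec(1)[OF St_sec(2)[OF assms that] p_pos] that by (simp add: w sec_ev)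
  then have "p dvd (\<Sum>y<p. na (wsec w y))"
    using na_dvd p_pos by (intro dvd_sum) auto
  moreover have "(\<Sum>y<p. na (wsec w y)) + nb w = p * nb w"
    unfolding sum_nb_wsec[of w, symmetric] sum.distrib[symmetric] na_nb
    by (simp add: sum_nb_wsec)
  ultimately have "p dvd nb w"
    by (metis dvd_add_right_iff dvd_triv_left)
  then show ?thesis
    using \<open>p dvd na w\<close> na_nb[of w] unfolding w ev_in_K by (metis dvd_add)
qed

lemma zeta_minus_1_dvd: "\<zeta> - 1 dvd \<zeta> ^ n - 1"
  by (simp add: power_diff_1_eq)

text \<open>Subtracting the unweighted relation from the weighted one changes the weights to
  \<open>\<zeta> ^ y - 1\<close>, all divisible by \<open>\<zeta> - 1\<close>; each level thus gains
  one factor. The offset two is the level from which \<open>g\<close> is known to lie in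
  \<open>K\<close>.\<close>

lemma T_St: "g \<in> St (Suc (Suc n)) \<Longrightarrow> \<exists>f. T g \<doteq> (\<zeta> - 1) ^ n * f"
proof (induction n arbitrary: g)
  case (Suc n)
  have sec: "sec g y \<in> St (Suc (Suc n))" if "y < p" for y
    using St_sec(2)[OF Suc.prems that] .
  then have "\<forall>y. \<exists>f. y < p \<longrightarrow> T (sec g y) \<doteq> (\<zeta> - 1) ^ n * f"
    using Suc.IH by blast
  then obtain f where f: "\<And>y. y < p \<Longrightarrow> T (sec g y) \<doteq> (\<zeta> - 1) ^ n * f y"
    by metis
  have "g \<in> K"
    using St_2_K St_mono[of "Suc (Suc 0)" "Suc (Suc (Suc n))"] Suc.prems by auto
  note l = level_one[OF St_G[OF Suc.prems] St_sec(1)[OF Suc.prems p_pos] p_pos]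
  obtain c where c: "\<And>y. \<zeta> ^ y - 1 = (\<zeta> - 1) * c y"
    using zeta_minus_1_dvd unfolding dvd_def by metis
  have "T g \<doteq> \<zeta> * (\<Sum>y<p. \<zeta> ^ y * T (sec g y)) - \<zeta> * 0"
    using l(3) by simp
  also have "\<dots> \<doteq> \<zeta> * (\<Sum>y<p. \<zeta> ^ y * T (sec g y)) - \<zeta> * (\<Sum>y<p. T (sec g y))"
    using l(5)[OF \<open>g \<in> K\<close>] by (intro cg_diff cg_mult_left cg_refl) (rule cg_sym)
  also have "\<dots> = \<zeta> * (\<Sum>y<p. (\<zeta> ^ y - 1) * T (sec g y))"
    by (simp add: algebra_simps sum_subtractf)
  also have "\<dots> \<doteq> \<zeta> * (\<Sum>y<p. (\<zeta> ^ y - 1) * ((\<zeta> - 1) ^ n * f y))"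
    using f by (intro cg_mult_left cg_sum) auto
  also have "\<dots> = (\<zeta> - 1) ^ Suc n * (\<zeta> * (\<Sum>y<p. c y * f y))"
    unfolding c by (simp add: sum_distrib_left ac_simps)
  finally show ?case by blast
qed (auto intro: cg_refl)

lemma T_St_prime_power:
  assumes "g \<in> St (p * s + 2)"
  shows "g \<in> K" "\<exists>f. T g \<doteq> of_nat (p ^ s) * f"
proof -
  show "g \<in> K"
    using St_2_K St_mono[of "Suc (Suc 0)" "p * s + 2"] assms by auto
  obtain h where h: "(\<zeta> - 1) ^ p \<doteq> of_nat p * h"
    using zeta_minus_1_power_p by blast
  have "(\<zeta> - 1) ^ (p * s) \<doteq> of_nat (p ^ s) * h ^ s"
  proof (induction s)
    case (Suc s)
    have "(\<zeta> - 1) ^ p * (\<zeta> - 1) ^ (p * s) \<doteq> (of_nat p * h) * (of_nat (p ^ s) * h ^ s)"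
      using h Suc by (rule cg_mult)
    then show ?case by (simp add: power_add ac_simps)
  qed simp
  moreover obtain f where "T g \<doteq> (\<zeta> - 1) ^ (p * s) * f"
    using T_St[of g "p * s"] assms by auto
  ultimately have "T g \<doteq> (of_nat (p ^ s) * h ^ s) * f"
    using cg_mult[OF _ cg_refl] cg_trans by blast
  then show "\<exists>f. T g \<doteq> of_nat (p ^ s) * f"
    by (auto simp: mult.assoc)
qed

text \<open>Divide \<open>T g\<close> by \<open>p ^ s\<close> in \<open>A\<close> and lift the
  quotient through \<open>T\<close> to an element \<open>h\<close>.\<close>

lemma St_power_mod_R: "\<exists>m. \<forall>g\<in>St m. \<exists>h\<in>K. \<exists>r\<in>R. g = h ^ p ^ s * r"
proof (intro exI[of _ "p * s + 2"] ballI)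
  fix g assume g: "g \<in> St (p * s + 2)"
  then obtain f where f: "T g \<doteq> of_nat (p ^ s) * f" and gK: "g \<in> K"
    using T_St_prime_power by blast
  obtain h where h: "h \<in> K" "T h \<doteq> f" using T_surj by blast
  have "T (h ^ p ^ s) \<doteq> of_nat (p ^ s) * f"
    by (rule cg_trans[OF T_power_K[OF h(1)] cg_mult_left[OF h(2)]])
  then have "inverse (h ^ p ^ s) * g \<in> R"
    using f gK h cg_sym cg_trans by (intro quotient_in_R) (blast intro: K_closed)+
  then show "\<exists>h\<in>K. \<exists>r\<in>R. g = h ^ p ^ s * r"
    using h(1) by (intro bexI[of _ h] bexI[of _ "inverse (h ^ p ^ s) * g"]) auto
qed

section \<open>\<open>R\<close> as the commutator subgroup of \<open>K\<close>\<close>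

lemma quotient_in_R':
  assumes "g \<in> K" "h \<in> K" "T g \<doteq> T h"
  shows "h * inverse g \<in> R"
  using is_normalD(3)[OF is_normal_R K_G[OF assms(1)] quotient_in_R[OF assms]]
  by (simp add: mult.assoc)

lemma commutator_in_R: "g \<in> K \<Longrightarrow> h \<in> K \<Longrightarrow> commutator g h \<in> R"
proof -
  assume *: "g \<in> K" "h \<in> K"
  have "T (h * g) \<doteq> T h + T g" "T g + T h \<doteq> T (g * h)"
    using * by (auto intro: T_mult_K cg_sym K_G)
  then have "T (h * g) \<doteq> T (g * h)"
    by (simp add: add.commute) (rule cg_trans)
  then have "(g * h) * inverse (h * g) \<in> R"
    using * by (intro quotient_in_R' K_closed)
  then show ?thesis by (simp add: commutator_def word_simps)
qed

definition gen_conj :: "nat \<Rightarrow> tree_aut" where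
  "gen_conj i = rot p ^ i * gen * inverse (rot p ^ i)"

lemma gen_conj_in_K: "gen_conj i \<in> K"
  using is_normalD(3)[OF is_normal_K G_closed(4)[OF rot_in_G] gen_in_K] by (simp add: gen_conj_def)

lemma T_gen_conj: "T (gen_conj i) \<doteq> \<zeta> ^ i"
proof -
  have "na (replicate i False) = i" for i by (induction i) auto
  then have "len (rot p ^ i) mod p = i mod p"
    using len_ev[of "replicate i False"] by (simp add: ev_replicate)
  then have "\<zeta> ^ len (rot p ^ i) * T gen \<doteq> \<zeta> ^ i * 1"
    by (intro cg_mult T_gen zeta_power_cong)
  then show ?thesis
    unfolding gen_conj_def
    using cg_trans[OF T_conj[OF G_closed(4)[OF rot_in_G] gen_in_K]] by simp
qed

lemma gen_conj_Suc: "rot p * gen_conj i * inverse (rot p) = gen_conj (Suc i)"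
  by (simp add: gen_conj_def word_simps)

lemma gen_conj_mod: "gen_conj (i mod p) = gen_conj i"
proof -
  have "rot p ^ i = rot p ^ (p * (i div p) + i mod p)" by simp
  also have "\<dots> = rot p ^ (i mod p)"
    unfolding power_add power_mult rot_power_p by simp
  finally show ?thesis by (simp add: gen_conj_def)
qed

definition gen_prod :: "nat list \<Rightarrow> tree_aut" where
  "gen_prod is = prod_list (map gen_conj is)"

lemma gen_prod_simps [simp]:
  "gen_prod [] = 1" "gen_prod (i # is) = gen_conj i * gen_prod is"
  "gen_prod (is @ js) = gen_prod is * gen_prod js"
  by (simp_all add: gen_prod_def)

lemma gen_prod_in_K: "gen_prod is \<in> K"
  by (induction "is") (auto intro: K_closed gen_conj_in_K)

lemma T_gen_prod: "T (gen_prod is) \<doteq> (\<Sum>i\<leftarrow>is. \<zeta> ^ i)"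
proof (induction "is")
  case (Cons i "is")
  have "T (gen_prod (i # is)) \<doteq> T (gen_conj i) + T (gen_prod is)"
    by (simp add: T_mult_K gen_conj_in_K K_G gen_prod_in_K)
  also have "\<dots> \<doteq> \<zeta> ^ i + (\<Sum>i\<leftarrow>is. \<zeta> ^ i)"
    by (intro cg_add T_gen_conj Cons)
  finally show ?case by simp
qed (simp add: T_one)

lemma gen_prod_upt: "gen_prod [0..<n] = dir p ^ n * inverse (rot p ^ n)"
proof (induction n)
  case (Suc n)
  have "gen_prod [0..<Suc n] = dir p ^ n * dir p * (inverse (rot p) * inverse (rot p ^ n))"
    using Suc by (simp add: gen_conj_def gen_def mult.assoc)
  also have "inverse (rot p) * inverse (rot p ^ n) = inverse (rot p ^ Suc n)"
    unfolding power_Suc2 mult_group_inverse_mult ..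
  also have "dir p ^ n * dir p = dir p ^ Suc n" by (rule power_Suc2[symmetric])
  finally show ?case .
qed simp

text \<open>The relation \<open>norm_poly \<doteq> 0\<close> already holds in the group: the product
  over one cycle telescopes to \<open>dir p ^ p * inverse (rot p ^ p)\<close>.\<close>

lemma gen_prod_cycles: "gen_prod (concat (replicate n [0..<p])) = 1"
  by (induction n) (simp_all add: gen_prod_upt rot_power_p dir_power_p)

text \<open>
  A polynomial of degree below \<open>p\<close> that is divisible by \<open>1 + \<zeta> + \<dots> + \<zeta>\<^sup>p\<^sup>-\<^sup>1\<close> is a constant
  multiple of it.
\<close>

lemma count_constant:
  assumes "set is \<subseteq> {..<p}" "(\<Sum>i\<leftarrow>is. \<zeta> ^ i) \<doteq> 0"
  shows "\<exists>n. mset is = mset (concat (replicate n [0..<p]))"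
proof -
  have zeta: "\<zeta> ^ i = Polynomial.monom 1 i" for i
    by (simp add: \<zeta>_def monom_altdef)
  define f where "f = (\<Sum>i\<leftarrow>is. \<zeta> ^ i)"
  have coeff_f: "Polynomial.coeff f i = int (count (mset is) i)" for i
    unfolding f_def by (induction "is") (auto simp: zeta)
  have coeff_norm: "Polynomial.coeff norm_poly i = (if i < p then 1 else 0)" for i
    by (simp add: norm_poly_def zeta Polynomial.coeff_sum)
  have deg_norm: "Polynomial.degree norm_poly = p - 1"
  proof (rule antisym)
    show "Polynomial.degree norm_poly \<le> p - 1"
      by (rule Polynomial.degree_le) (auto simp: coeff_norm)
    show "p - 1 \<le> Polynomial.degree norm_poly"
      using p_pos by (intro le_degree) (simp add: coeff_norm)
  qed
  have norm0: "norm_poly \<noteq> 0"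
    using coeff_norm[of 0] p_pos by auto
  have deg_f: "Polynomial.degree f \<le> p - 1"
  proof (rule Polynomial.degree_le, intro allI impI)
    fix i assume "p - 1 < i"
    then have "i \<notin> set is" using assms(1) by auto
    then show "Polynomial.coeff f i = 0"
      by (simp add: coeff_f count_eq_zero_iff)
  qed
  obtain q where q: "f = norm_poly * q"
    using assms(2) by (auto simp: cg_def f_def)
  have "Polynomial.degree q = 0"
  proof (cases "q = 0")
    case False
    then show ?thesis
      using deg_f norm0 by (simp add: q Polynomial.degree_mult_eq deg_norm)
  qed simp
  then obtain c where "q = [:c:]" by (metis degree_eq_zeroE)
  then have c: "int (count (mset is) i) = (if i < p then c else 0)" for i
    unfolding coeff_f[symmetric] by (simp add: q coeff_norm)
  have n: "count (mset (concat (replicate n [0..<p]))) i = (if i < p then n else 0)" for n i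
    by (induction n) auto
  have "mset is = mset (concat (replicate (nat c) [0..<p]))"
  proof (rule multiset_eqI)
    fix i
    have "count (mset is) i = nat (if i < p then c else 0)"
      by (simp only: c[symmetric] nat_int)
    then show "count (mset is) i = count (mset (concat (replicate (nat c) [0..<p]))) i"
      unfolding n by simp
  qed
  then show ?thesis ..
qed

text \<open>Modulo \<open>D\<close> an element of \<open>K\<close> is a product of the
  \<open>gen_conj i\<close> with \<open>i < p\<close>, in any order. If it lies in \<open>R\<close>,
  all of them occur equally often by \<open>count_constant\<close>, and full cycles multiply to 1.
  The lemma is the induction principle for \<open>R\<close>: it suffices to treat commutators of
  \<open>K\<close>.\<close>

lemma R_subset:
  assumes sub: "is_subgroup D" and conj: "\<And>g d. g \<in> G \<Longrightarrow> d \<in> D \<Longrightarrow> g * d * inverse g \<in> D"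
    and comm: "\<And>g h. g \<in> K \<Longrightarrow> h \<in> K \<Longrightarrow> commutator g h \<in> D"
  shows "R \<subseteq> D"
proof
  fix r assume r: "r \<in> R"
  \<comment> \<open>Intersecting with \<open>R\<close> lets membership in \<open>R\<close> pass from
    \<open>r\<close> to the product that is \<open>sim\<close> to it.\<close>
  define E where "E = D \<inter> R"
  note E_closed = is_subgroupD[OF is_subgroup_Int[OF sub is_normalD(2)[OF is_normal_R]], folded E_def]
  define sim where "sim g h \<longleftrightarrow> g * inverse h \<in> E" for g h
  have sim_refl: "sim g g" for g
    by (simp add: sim_def E_closed)
  have sim_trans: "sim g k" if "sim g h" "sim h k" for g h k
    using E_closed(2)[of "g * inverse h" "h * inverse k"] that by (simp add: sim_def mult.assoc)
  have sim_sym: "sim h g" if "sim g h" for g h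
    using E_closed(3)[of "g * inverse h"] that by (simp add: sim_def mult_group_inverse_mult)
  have E_conj: "g * d * inverse g \<in> E" if "g \<in> G" "d \<in> E" for g d
    using that conj is_normalD(3)[OF is_normal_R] by (auto simp: E_def)
  have sim_mult: "sim (g * h) (g' * h')" if "g \<in> G" "sim g g'" "sim h h'" for g h g' h'
    using E_closed(2)[OF E_conj[OF that(1), of "h * inverse h'"], of "g * inverse g'"] that
    by (simp add: sim_def word_simps)
  have sim_comm: "sim (g * h) (h * g)" if "g \<in> K" "h \<in> K" for g h
    using comm[OF that] commutator_in_R[OF that]
    by (simp add: sim_def E_def commutator_def word_simps)
  have sim_conj: "sim (g * h * inverse g) (g * h' * inverse g)" if "sim h h'" "g \<in> G" for g h h'
    using E_conj[OF that(2), of "h * inverse h'"] that(1) by (simp add: sim_def word_simps)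
  have rot_conj: "rot p * gen_prod is * inverse (rot p) = gen_prod (map (\<lambda>i. Suc i mod p) is)" for "is"
  proof (induction "is")
    case (Cons i "is")
    have "rot p * gen_prod (i # is) * inverse (rot p)
        = (rot p * gen_conj i * inverse (rot p)) * (rot p * gen_prod is * inverse (rot p))"
      by (simp add: mult.assoc)
    then show ?case using Cons by (simp add: gen_conj_Suc gen_conj_mod)
  qed simp
  have reduce: "\<exists>is. set is \<subseteq> {..<p} \<and> sim k (gen_prod is)" if "k \<in> K" for k
    using that
  proof (induction rule: K_induct)
    case one
    show ?case by (rule exI[of _ "[]"]) (simp add: sim_refl)
  next
    case gen
    show ?case using p_pos
      by (intro exI[of _ "[0]"]) (simp add: gen_conj_def sim_refl)
  next
    case (mult g h)
    then obtain "is" js where *: "set is \<subseteq> {..<p}" "sim g (gen_prod is)" "set js \<subseteq> {..<p}" "sim h (gen_prod js)"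
      by blast
    then have "sim (g * h) (gen_prod (is @ js))"
      using K_G[OF mult(1)] by (simp add: sim_mult)
    then show ?case using * by (metis set_append Un_least)
  next
    case (rot g)
    then obtain "is" where js: "set is \<subseteq> {..<p}" "sim g (gen_prod is)" by blast
    have "sim (rot p * g * inverse (rot p)) (gen_prod (map (\<lambda>i. Suc i mod p) is))"
      using sim_conj[OF js(2) rot_in_G] by (simp add: rot_conj)
    then show ?case using p_pos by (intro exI[of _ "map (\<lambda>i. Suc i mod p) is"]) auto
  next
    case (dir g)
    then obtain "is" where js: "set is \<subseteq> {..<p}" "sim g (gen_prod is)" by blast
    \<comment> \<open>Conjugation by \<open>dir p\<close> is conjugation by \<open>rot p\<close>
      followed by conjugation by \<open>gen\<close>, and the latter is trivial modulo commutators of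
      \<open>K\<close>.\<close>
    define k where "k = rot p * g * inverse (rot p)"
    have k: "k \<in> K" using is_normalD(3)[OF is_normal_K rot_in_G dir(1)] by (simp add: k_def)
    have "sim (gen * k * inverse gen) (k * gen * inverse gen)"
      using sim_mult[OF K_G[OF K_closed(2)[OF gen_in_K k]] sim_comm[OF gen_in_K k] sim_refl] .
    moreover have "gen * k * inverse gen = dir p * g * inverse (dir p)"
      by (simp add: gen_def k_def word_simps)
    ultimately have "sim (dir p * g * inverse (dir p)) k"
      by (simp add: mult.assoc)
    moreover have "sim k (gen_prod (map (\<lambda>i. Suc i mod p) is))"
      using sim_conj[OF js(2) rot_in_G] by (simp add: rot_conj k_def)
    ultimately have "sim (dir p * g * inverse (dir p)) (gen_prod (map (\<lambda>i. Suc i mod p) is))"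
      by (rule sim_trans)
    then show ?case using p_pos by (intro exI[of _ "map (\<lambda>i. Suc i mod p) is"]) auto
  qed
  have perm: "sim (gen_prod is) (gen_prod js)" if "mset is = mset js" for "is" js
    using that
  proof (induction "is" arbitrary: js)
    case (Cons i "is")
    then have "i \<in> set js" by (metis list.set_intros(1) set_mset_mset)
    then obtain js1 js2 where js: "js = js1 @ i # js2" by (meson split_list)
    have "sim (gen_prod is) (gen_prod (js1 @ js2))"
      using Cons js by (intro Cons.IH) auto
    then have "sim (gen_conj i * gen_prod is) (gen_conj i * gen_prod (js1 @ js2))"
      by (intro sim_mult sim_refl K_G gen_conj_in_K)
    moreover have "sim ((gen_conj i * gen_prod js1) * gen_prod js2) ((gen_prod js1 * gen_conj i) * gen_prod js2)"
      by (intro sim_mult sim_refl sim_comm K_G K_closed gen_conj_in_K gen_prod_in_K)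
    ultimately show ?case
      using sim_trans by (simp add: js mult.assoc)
  qed (simp add: sim_refl)
  obtain "is" where js: "set is \<subseteq> {..<p}" "sim r (gen_prod is)"
    using reduce[OF R_K[OF r]] by blast
  have "inverse (r * inverse (gen_prod is)) * r \<in> R"
    using js(2) r by (intro R_closed(2)[OF R_closed(3)]) (auto simp: sim_def E_def)
  then have "gen_prod is \<in> R" by (simp add: word_simps)
  then have "(\<Sum>i\<leftarrow>is. \<zeta> ^ i) \<doteq> 0"
    using cg_trans[OF cg_sym[OF T_gen_prod]] by (auto simp: R_def)
  then obtain n where "mset is = mset (concat (replicate n [0..<p]))"
    using count_constant js(1) by blast
  then have "sim (gen_prod is) 1"
    using perm gen_prod_cycles by metis
  then have "sim r 1" using js(2) sim_trans by blast
  then show "r \<in> D" by (simp add: sim_def E_def)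
qed

section \<open>Normal subgroups of finite index\<close>

lemma branch_conj_plant1:
  "branch f * plant1 x r * inverse (branch f) = plant1 x (f x * r * inverse (f x))"
  by (auto simp: plant1_def branch_mult branch_inverse fun_eq_iff)

lemma plant_conj_lift:
  assumes "g \<in> G" "u \<in> vertices p"
  shows "\<exists>g'\<in>G. \<forall>h. g' * plant u h * inverse g' = plant u (g * h * inverse g)"
  using assms(2)
proof (induction u)
  case (Cons x u)
  then obtain g' where g': "g' \<in> G" "\<And>h. g' * plant u h * inverse g' = plant u (g * h * inverse g)"
    by auto
  obtain f where "branch f \<in> G" "f x = g'"
    using fractal[OF g'(1), of x] Cons.prems by auto
  then show ?case
    using g'(2) by (intro bexI[of _ "branch f"]) (simp_all add: branch_conj_plant1)
qed (use assms(1) in auto)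

lemma rot_conj_plant1:
  assumes "x < p"
  shows "rot p ^ n * plant1 x r * inverse (rot p ^ n) = plant1 ((x + n) mod p) r"
proof (induction n)
  case 0
  then show ?case using assms by simp
next
  case (Suc n)
  have conj: "rot p * plant1 y r * inverse (rot p) = plant1 (Suc y mod p) r" if "y < p" for y
  proof -
    have "rot p * plant1 y r = plant1 (Suc y mod p) r * rot p"
    proof (rule tree_aut_eqI)
      show "rt (rot p * plant1 y r) x = rt (plant1 (Suc y mod p) r * rot p) x" for x
        by (simp add: plant1_def)
      show "sec (rot p * plant1 y r) x = sec (plant1 (Suc y mod p) r * rot p) x" for x
        using that by (auto simp: plant1_def rt_rot mod_Suc)
    qed
    then show ?thesis by (simp add: mult.assoc)
  qed
  have "rot p ^ Suc n * plant1 x r * inverse (rot p ^ Suc n)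
      = rot p * (rot p ^ n * plant1 x r * inverse (rot p ^ n)) * inverse (rot p)"
    by (simp add: word_simps)
  also have "\<dots> = plant1 (Suc ((x + n) mod p) mod p) r"
    unfolding Suc by (rule conj) (use p_pos in simp)
  finally show ?case by (simp add: mod_Suc_eq)
qed

lemma plant_transitive:
  assumes "length u = length v" "u \<in> vertices p" "v \<in> vertices p"
  shows "\<exists>g\<in>G. \<forall>h. g * plant u h * inverse g = plant v h"
  using assms
proof (induction u v rule: list_induct2)
  case Nil
  show ?case using G_closed(1) by (intro bexI[of _ 1]) simp_all
next
  case (Cons x u y v)
  then obtain g where g: "g \<in> G" "\<And>h. g * plant u h * inverse g = plant v h"
    by auto
  have x: "x < p" "y < p" using Cons.prems by auto
  then obtain f where f: "branch f \<in> G" "f x = g"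
    using fractal[OF g(1), of x] by auto
  \<comment> \<open>A nonnegative exponent of \<open>rot p\<close> that carries vertex
    \<open>x\<close> to \<open>y\<close>.\<close>
  define j where "j = y + (p - x)"
  have "(rot p ^ j * branch f) * plant (x # u) h * inverse (rot p ^ j * branch f) = plant (y # v) h" for h
  proof -
    have "(rot p ^ j * branch f) * plant (x # u) h * inverse (rot p ^ j * branch f)
        = rot p ^ j * (branch f * plant1 x (plant u h) * inverse (branch f)) * inverse (rot p ^ j)"
      by (simp add: word_simps)
    also have "\<dots> = plant1 ((x + j) mod p) (plant v h)"
      using x f g(2) by (simp add: branch_conj_plant1 rot_conj_plant1)
    also have "(x + j) mod p = y" using x by (simp add: j_def)
    finally show ?thesis by simp
  qed
  then show ?case
    using f(1) rot_in_G G_closed by metis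
qed

lemma two_others: "\<exists>j l. j < p \<and> l < p \<and> j \<noteq> i \<and> l \<noteq> i \<and> j \<noteq> l"
proof -
  have "(if i = 0 then 1 else 0) < p" "(if i = 2 then 1 else 2) < p" using p_ge_5 by auto
  then show ?thesis
    by (intro exI[of _ "if i = 0 then 1 else 0"] exI[of _ "if i = 2 then 1 else 2"]) auto
qed

lemma commutator_pairs:
  assumes "i \<noteq> j" "i \<noteq> l" "j \<noteq> l"
  shows "commutator (branch (pair i j k k')) (branch (pair i l h h')) = plant1 i (commutator k h)"
  using assms by (auto simp: commutator_def branch_mult branch_inverse plant1_def pair_def fun_eq_iff)

text \<open>Two pairs that share only the vertex \<open>i\<close> have a commutator supported at
  \<open>i\<close> alone, which plants commutators of \<open>K\<close>. \<open>R_subset\<close>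
  first gives membership in \<open>G\<close>; the section values, all 0, then give membership in
  \<open>R\<close>.\<close>

lemma plant1_in_R:
  assumes "r \<in> R" "i < p"
  shows "plant1 i r \<in> R"
proof -
  have "R \<subseteq> {g. plant1 i g \<in> G}"
  proof (rule R_subset)
    show "is_subgroup {g. plant1 i g \<in> G}"
      by (auto simp: is_subgroup_def plant1_mult plant1_inverse G_closed)
    show "g * d * inverse g \<in> {g. plant1 i g \<in> G}" if gd: "g \<in> G" "d \<in> {g. plant1 i g \<in> G}" for g d
    proof -
      obtain f where "branch f \<in> G" "f i = g" using fractal[OF gd(1) assms(2)] by blast
      then show ?thesis
        using gd(2) by (auto simp: G_closed simp flip: branch_conj_plant1)
    qed
    show "commutator g h \<in> {g. plant1 i g \<in> G}" if gh: "g \<in> K" "h \<in> K" for g h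
    proof -
      obtain j l where jl: "j < p" "l < p" "j \<noteq> i" "l \<noteq> i" "j \<noteq> l"
        using two_others by blast
      obtain g' where g': "branch (pair i j g g') \<in> G"
        using pair_exists[OF gh(1) assms(2) jl(1)] jl by auto
      obtain h' where h': "branch (pair i l h h') \<in> G"
        using pair_exists[OF gh(2) assms(2) jl(2)] jl by auto
      have "commutator (branch (pair i j g g')) (branch (pair i l h h')) \<in> G"
        using g' h' unfolding commutator_def by (intro G_closed)
      then show ?thesis using jl by (simp add: commutator_pairs)
    qed
  qed
  then have G: "branch ((\<lambda>_. 1)(i := r)) \<in> G" using assms(1) by (auto simp: plant1_def)
  note l = branch_level_one[OF G assms(2)]
  have "T (((\<lambda>_. 1)(i := r)) y) \<doteq> 0" for y
    using assms(1) T_one by (simp add: R_def)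
  then have "\<zeta> * (\<Sum>y<p. \<zeta> ^ y * T (((\<lambda>_. 1)(i := r)) y)) \<doteq> \<zeta> * (\<Sum>y<p. \<zeta> ^ y * 0)"
    by (intro cg_mult_left cg_sum)
  then have "T (branch ((\<lambda>_. 1)(i := r))) \<doteq> 0"
    using cg_trans[OF l(2)] R_K[OF assms(1)] by simp
  then show ?thesis using l(1) R_K[OF assms(1)] by (simp add: R_def plant1_def)
qed

lemma plant_in_R: "r \<in> R \<Longrightarrow> u \<in> vertices p \<Longrightarrow> plant u r \<in> R"
  by (induction u) (auto intro: plant1_in_R)

text \<open>The factor \<open>\<zeta> ^ (p - 1 - i)\<close> is chosen to complete
  \<open>\<zeta> * \<zeta> ^ i\<close> to \<open>\<zeta> ^ p\<close>.\<close>

lemma pair_with_T: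
  assumes "Suc i < p"
  shows "\<exists>k k'. branch (pair i (Suc i) k k') \<in> K \<and> T (branch (pair i (Suc i) k k')) \<doteq> (1 - \<zeta>) * f"
proof -
  obtain k where k: "k \<in> K" "T k \<doteq> \<zeta> ^ (p - 1 - i) * f" using T_surj by blast
  obtain k' where k': "branch (pair i (Suc i) k k') \<in> G"
    using pair_exists[OF k(1)] assms by fastforce
  note P = T_branch_pair[OF k' k(1)]
  have "T (branch (pair i (Suc i) k k')) \<doteq> \<zeta> * (\<zeta> ^ i - \<zeta> ^ Suc i) * T k"
    using assms by (intro P) auto
  also have "\<dots> \<doteq> \<zeta> * (\<zeta> ^ i - \<zeta> ^ Suc i) * (\<zeta> ^ (p - 1 - i) * f)"
    by (intro cg_mult_left k)
  also have "\<dots> = \<zeta> ^ (1 + i + (p - 1 - i)) * ((1 - \<zeta>) * f)"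
    by (simp add: algebra_simps power_add)
  also have "1 + i + (p - 1 - i) = p" using assms by simp
  also have "\<zeta> ^ p * ((1 - \<zeta>) * f) \<doteq> 1 * ((1 - \<zeta>) * f)"
    by (intro cg_mult zeta_power_p cg_refl)
  finally have "T (branch (pair i (Suc i) k k')) \<doteq> (1 - \<zeta>) * f" by simp
  moreover have "branch (pair i (Suc i) k k') \<in> K"
    using assms by (intro P) auto
  ultimately show ?thesis by blast
qed

text \<open>
  Modulo \<open>L\<close> the commutator map on \<open>K\<close> is bimultiplicative and factors through \<open>T\<close>. Elements
  supported below disjoint pairs of first-level vertices commute, and their values under \<open>T\<close>
  exhaust the ideal generated by \<open>1 - \<zeta>\<close>; hence the commutator vanishes on that ideal, in
  particular on the elements whose commutators generate the planted copy of \<open>R\<close>.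
  This needs four first-level vertices.
\<close>

lemma plant1_in_normal:
  assumes L: "is_normal L G" and RK: "\<And>r k. r \<in> R \<Longrightarrow> k \<in> K \<Longrightarrow> commutator r k \<in> L"
    and r: "r \<in> R" and i: "i < p"
  shows "plant1 i r \<in> L"
proof -
  note L_closed = is_normalD(3-6)[OF L]
  have sym: "commutator y x \<in> L" if "commutator x y \<in> L" for x y
    using L_closed(4)[OF that] by (simp add: commutator_def word_simps)
  have mult: "commutator (x * x') y \<in> L"
    if "x \<in> G" "commutator x y \<in> L" "commutator x' y \<in> L" for x x' y
    using L_closed(3)[OF L_closed(1)[OF that(1,3)] that(2)] by (simp add: commutator_def word_simps)
  have comm: "commutator g h \<in> L"
    if "g \<in> K" "h \<in> K" "T g \<doteq> (1 - \<zeta>) * f" "T h \<doteq> (1 - \<zeta>) * f'" for g h f f'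
  proof -
    have four: "Suc 0 < p" "Suc 2 < p" using p_ge_5 by auto
    obtain k k' where e: "branch (pair 0 (Suc 0) k k') \<in> K" "T (branch (pair 0 (Suc 0) k k')) \<doteq> (1 - \<zeta>) * f"
      using pair_with_T[OF four(1)] by blast
    obtain l l' where e': "branch (pair 2 (Suc 2) l l') \<in> K" "T (branch (pair 2 (Suc 2) l l')) \<doteq> (1 - \<zeta>) * f'"
      using pair_with_T[OF four(2)] by blast
    define E where "E = branch (pair 0 (Suc 0) k k')"
    define E' where "E' = branch (pair 2 (Suc 2) l l')"
    have "E * E' = E' * E"
      by (auto simp: E_def E'_def branch_mult pair_def fun_eq_iff)
    then have "commutator E E' \<in> L"
      using L_closed(2) by (simp add: commutator_eq_one_iff[THEN iffD2])
    \<comment> \<open>\<open>E\<close> and \<open>g\<close> have equal values under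
      \<open>T\<close>, as do \<open>E'\<close> and \<open>h\<close>; the quotients lie in
      \<open>R\<close>, whose commutators with \<open>K\<close> are in \<open>L\<close> by
      \<open>RK\<close>.\<close>
    define s where "s = inverse E * g"
    define s' where "s' = inverse E' * h"
    have s: "s \<in> R" "s' \<in> R"
      unfolding s_def s'_def E_def E'_def
      by (rule quotient_in_R[OF e(1) that(1) cg_trans[OF e(2) cg_sym[OF that(3)]]],
          rule quotient_in_R[OF e'(1) that(2) cg_trans[OF e'(2) cg_sym[OF that(4)]]])
    have E: "E \<in> K" "E' \<in> K" using e(1) e'(1) by (simp_all add: E_def E'_def)
    have "commutator (E' * s') E \<in> L"
      by (rule mult[OF K_G[OF E(2)] sym[OF \<open>commutator E E' \<in> L\<close>] RK[OF s(2) E(1)]])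
    moreover have "h = E' * s'" by (simp add: s'_def)
    ultimately have "commutator E h \<in> L" by (simp add: sym)
    then have "commutator (E * s) h \<in> L"
      by (rule mult[OF K_G[OF E(1)] _ RK[OF s(1) that(2)]])
    then show ?thesis by (simp add: s_def)
  qed
  have "R \<subseteq> {g. plant1 i g \<in> L}"
  proof (rule R_subset)
    show "is_subgroup {g. plant1 i g \<in> L}"
      by (auto simp: is_subgroup_def plant1_mult plant1_inverse L_closed)
    show "g * d * inverse g \<in> {g. plant1 i g \<in> L}" if gd: "g \<in> G" "d \<in> {g. plant1 i g \<in> L}" for g d
    proof -
      obtain f where "branch f \<in> G" "f i = g" using fractal[OF gd(1) i] by blast
      then show ?thesis
        using gd(2) L_closed(1) by (auto simp flip: branch_conj_plant1)
    qed
    show "commutator g h \<in> {g. plant1 i g \<in> L}" if gh: "g \<in> K" "h \<in> K" for g h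
    proof -
      \<comment> \<open>\<open>\<zeta> ^ i - \<zeta> ^ j\<close> is a multiple of
        \<open>1 - \<zeta>\<close>, so elements supported on a pair have values in the ideal handled
        by \<open>comm\<close>.\<close>
      have dvd: "\<exists>f. T (branch (pair i j k k')) \<doteq> (1 - \<zeta>) * f \<and> branch (pair i j k k') \<in> K"
        if "branch (pair i j k k') \<in> G" "k \<in> K" "j < p" "j \<noteq> i" for j k k'
      proof -
        obtain c c' where c: "\<zeta> ^ i - 1 = (\<zeta> - 1) * c" "\<zeta> ^ j - 1 = (\<zeta> - 1) * c'"
          using zeta_minus_1_dvd unfolding dvd_def by blast
        have "\<zeta> ^ i - \<zeta> ^ j = (\<zeta> ^ i - 1) - (\<zeta> ^ j - 1)" by simp
        also have "\<dots> = (1 - \<zeta>) * (c' - c)" unfolding c by (simp add: algebra_simps)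
        finally have "\<zeta> * (\<zeta> ^ i - \<zeta> ^ j) * T k = (1 - \<zeta>) * (\<zeta> * (c' - c) * T k)" by simp
        then show ?thesis
          using T_branch_pair(1,4)[OF that(1,2) i that(3)] that(4) by metis
      qed
      obtain j l where jl: "j < p" "l < p" "j \<noteq> i" "l \<noteq> i" "j \<noteq> l"
        using two_others by blast
      obtain g' where g': "branch (pair i j g g') \<in> G"
        using pair_exists[OF gh(1) i jl(1)] jl by auto
      obtain h' where h': "branch (pair i l h h') \<in> G"
        using pair_exists[OF gh(2) i jl(2)] jl by auto
      have "commutator (branch (pair i j g g')) (branch (pair i l h h')) \<in> L"
        using dvd[OF g' gh(1)] dvd[OF h' gh(2)] jl comm by blast
      then show ?thesis using jl by (simp add: commutator_pairs)
    qed
  qed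
  then show ?thesis using r by auto
qed

text \<open>Here \<open>q\<close> is any map whose fibres on \<open>G\<close> are the cosets of
  \<open>N\<close>; it stands for the projection to the finite quotient.\<close>

lemma finite_index_contains_plants:
  assumes N: "is_normal N G" and fin: "finite (q ` G)"
    and q: "\<And>g h. g \<in> G \<Longrightarrow> h \<in> G \<Longrightarrow> q g = q h \<longleftrightarrow> g * inverse h \<in> N"
  shows "\<exists>n. \<forall>u\<in>vertices p. length u = n \<longrightarrow> (\<forall>r\<in>R. plant u r \<in> N)"
proof -
  note N_closed = is_normalD(3-6)[OF N]
  define S where "S u = q ` plant u ` R" for u
  \<comment> \<open>By minimality the image of the planted copy of \<open>R\<close> cannot shrink
    further on passing to a child of \<open>u\<close>.\<close>
  obtain u where u: "u \<in> vertices p" and min: "\<And>v. v \<in> vertices p \<Longrightarrow> card (S u) \<le> card (S v)"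
    using ex_has_least_nat[of "\<lambda>u. u \<in> vertices p" "[]" "\<lambda>u. card (S u)"] by auto
  have ux: "u @ [x] \<in> vertices p" if "x < p" for x
    using u that by (simp add: vertices_def)
  have "S u \<subseteq> q ` G"
    using plant_in_R u R_G by (auto simp: S_def)
  then have "finite (S u)" using fin finite_subset by blast
  have S: "S (u @ [x]) = S u" if "x < p" for x
  proof (rule card_seteq[OF \<open>finite (S u)\<close>])
    show "S (u @ [x]) \<subseteq> S u"
      using plant1_in_R that by (auto simp: S_def plant_append)
    show "card (S u) \<le> card (S (u @ [x]))"
      using min ux that by blast
  qed
  have x: "0 < p" "1 < p" "2 < p" using p_ge_5 by auto
  have comm: "plant (u @ [0]) (commutator r k) \<in> N" if r: "r \<in> R" and k: "k \<in> K" for r k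
  proof -
    \<comment> \<open>Modulo \<open>N\<close> the element planted at child 0 equals one planted at
      child 2. The conjugator \<open>e\<close> below acts as \<open>k\<close> at child 0 and
      trivially at child 2, so the planted commutator becomes a product of \<open>n\<close> and a
      conjugate of its inverse.\<close>
    have "q (plant (u @ [0]) r) \<in> S (u @ [2])"
      using S[OF x(1)] S[OF x(3)] r by (auto simp: S_def)
    then obtain r' where r': "r' \<in> R" "q (plant (u @ [0]) r) = q (plant (u @ [2]) r')"
      by (auto simp: S_def)
    define n where "n = plant (u @ [0]) r * inverse (plant (u @ [2]) r')"
    have n: "n \<in> N"
      using q[of "plant (u @ [0]) r" "plant (u @ [2]) r'"] r r' ux x plant_in_R R_G
      by (auto simp: n_def)
    obtain k' where k': "branch (pair 0 1 k k') \<in> G"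
      using pair_exists[OF k x(1,2)] by auto
    obtain e where e: "e \<in> G"
      "\<And>h. e * plant u h * inverse e = plant u (branch (pair 0 1 k k') * h * inverse (branch (pair 0 1 k k')))"
      using plant_conj_lift[OF k' u] by blast
    have e0: "e * plant (u @ [0]) h * inverse e = plant (u @ [0]) (k * h * inverse k)"
      and e2: "e * plant (u @ [2]) h * inverse e = plant (u @ [2]) h" for h
      by (simp_all add: plant_append e(2) branch_conj_plant1) (simp_all add: pair_def)
    have "plant (u @ [0]) (commutator r k)
        = plant (u @ [0]) r * plant (u @ [0]) (k * inverse r * inverse k)"
      by (simp add: commutator_def plant_mult[symmetric] mult.assoc)
    also have "\<dots> = plant (u @ [0]) r * (e * plant (u @ [0]) (inverse r) * inverse e)"
      by (simp only: e0)
    also have "plant (u @ [0]) (inverse r) = plant (u @ [2]) (inverse r') * inverse n"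
      by (simp add: n_def plant_inverse word_simps)
    also have "e * (plant (u @ [2]) (inverse r') * inverse n) * inverse e
        = (e * plant (u @ [2]) (inverse r') * inverse e) * (e * inverse n * inverse e)"
      by (simp add: word_simps)
    also have "plant (u @ [0]) r * \<dots> = n * (e * inverse n * inverse e)"
      unfolding e2 by (simp add: n_def plant_inverse word_simps)
    also have "\<dots> \<in> N" using n e(1) by (intro N_closed)
    finally show ?thesis .
  qed
  define L where "L = {g \<in> G. plant (u @ [0]) g \<in> N}"
  have L: "is_normal L G"
    unfolding is_normal_def is_subgroup_def
  proof (intro conjI ballI)
    show "g * h * inverse g \<in> L" if gh: "g \<in> G" "h \<in> L" for g h
    proof -
      obtain e where "e \<in> G" "e * plant (u @ [0]) h * inverse e = plant (u @ [0]) (g * h * inverse g)"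
        using plant_conj_lift[OF gh(1) ux[OF x(1)]] by blast
      then show ?thesis using gh N_closed(1)[of e "plant (u @ [0]) h"] by (simp add: L_def G_closed)
    qed
  qed (auto simp: L_def G_closed plant_mult plant_inverse N_closed)
  have "commutator r k \<in> L" if "r \<in> R" "k \<in> K" for r k
    using comm[OF that] R_G[OF commutator_in_R[OF R_K[OF that(1)] that(2)]] by (simp add: L_def)
  then have L0: "plant1 0 r \<in> L" if "r \<in> R" for r
    using plant1_in_normal[OF L] that x(1) by blast
  let ?v = "(u @ [0]) @ [0]"
  have v: "plant ?v r \<in> N" if "r \<in> R" for r
    using L0[OF that] by (simp add: L_def plant_append)
  have "?v \<in> vertices p" using u x by (simp add: vertices_def)
  show ?thesis
  proof (intro exI[of _ "length ?v"] ballI impI)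
    fix w r assume w: "w \<in> vertices p" "length w = length ?v" and r: "r \<in> R"
    obtain g where "g \<in> G" "g * plant ?v r * inverse g = plant w r"
      using plant_transitive[of ?v w] w \<open>?v \<in> vertices p\<close> by auto
    then show "plant w r \<in> N" using N_closed(1) v[OF r] by metis
  qed
qed

section \<open>Products of planted copies over a level\<close>

primrec RR :: "nat \<Rightarrow> tree_aut set" where
  "RR 0 = R"
| "RR (Suc n) = {branch \<rho> | \<rho>. (\<forall>x<p. \<rho> x \<in> RR n) \<and> (\<forall>x\<ge>p. \<rho> x = 1)}"

text \<open>An element is the product of its planted sections, collected vertex by vertex; the
  hypothesis is applied to the preimage of \<open>N\<close> under \<open>plant1 x\<close>.\<close>

lemma RR_subset:
  assumes "is_subgroup N" "\<And>u r. u \<in> vertices p \<Longrightarrow> length u = n \<Longrightarrow> r \<in> R \<Longrightarrow> plant u r \<in> N"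
  shows "RR n \<subseteq> N"
  using assms
proof (induction n arbitrary: N)
  case 0
  from 0(2)[of "[]"] show ?case by auto
next
  case (Suc n)
  show ?case
  proof
    fix g assume "g \<in> RR (Suc n)"
    then obtain \<rho> where \<rho>: "g = branch \<rho>" "\<And>x. x < p \<Longrightarrow> \<rho> x \<in> RR n" "\<And>x. p \<le> x \<Longrightarrow> \<rho> x = 1"
      by auto
    have plant: "plant1 x (\<rho> x) \<in> N" if "x < p" for x
    proof -
      have "RR n \<subseteq> {g. plant1 x g \<in> N}"
      proof (rule Suc.IH)
        show "is_subgroup {g. plant1 x g \<in> N}"
          using is_subgroupD[OF Suc.prems(1)] by (auto simp: is_subgroup_def plant1_mult plant1_inverse)
        show "plant u r \<in> {g. plant1 x g \<in> N}" if "u \<in> vertices p" "length u = n" "r \<in> R" for u r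
          using Suc.prems(2)[of "x # u" r] that \<open>x < p\<close> by simp
      qed
      then show ?thesis using \<rho>(2)[OF that] by auto
    qed
    have "branch (\<lambda>x. if x < m then \<rho> x else 1) \<in> N" if "m \<le> p" for m
      using that
    proof (induction m)
      case 0
      show ?case using is_subgroupD(1)[OF Suc.prems(1)] by (simp add: branch_one)
    next
      case (Suc m)
      have "branch (\<lambda>x. if x < m then \<rho> x else 1) * plant1 m (\<rho> m) = branch (\<lambda>x. if x < Suc m then \<rho> x else 1)"
        by (auto simp: plant1_def branch_mult fun_eq_iff less_Suc_eq)
      then show ?case
        using Suc plant[of m] is_subgroupD(2)[OF \<open>is_subgroup N\<close>] by (metis Suc_leD Suc_le_lessD)
    qed
    moreover have "(\<lambda>x. if x < p then \<rho> x else 1) = \<rho>" using \<rho>(3) by auto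
    ultimately show "g \<in> N" using \<rho>(1) by (metis le_refl)
  qed
qed

lemma RR_R: "RR n \<subseteq> R"
  by (rule RR_subset[OF is_normalD(2)[OF is_normal_R]]) (rule plant_in_R)

text \<open>Each \<open>pair\<close> sets one section freely at the cost of the section at
  \<open>p - 1\<close>, which absorbs all the corrections.\<close>

lemma branch_with_sections:
  assumes "\<And>j. j < p - 1 \<Longrightarrow> k j \<in> K"
  shows "\<exists>\<phi>. branch \<phi> \<in> G \<and> (\<forall>j<p - 1. \<phi> j = k j) \<and> (\<forall>j\<ge>p. \<phi> j = 1)"
proof -
  have "\<exists>\<phi>. branch \<phi> \<in> G \<and> (\<forall>j<n. \<phi> j = k j) \<and> (\<forall>j\<ge>n. j \<noteq> p - 1 \<longrightarrow> \<phi> j = 1)" if "n \<le> p - 1" for n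
    using that
  proof (induction n)
    case 0
    show ?case using G_closed(1) by (intro exI[of _ "\<lambda>_. 1"]) (simp add: branch_one)
  next
    case (Suc n)
    then obtain \<phi> where \<phi>: "branch \<phi> \<in> G" "\<And>j. j < n \<Longrightarrow> \<phi> j = k j" "\<And>j. n \<le> j \<Longrightarrow> j \<noteq> p - 1 \<Longrightarrow> \<phi> j = 1"
      by auto
    obtain k' where "branch (pair n (p - 1) (k n) k') \<in> G"
      using pair_exists[OF assms, of n n "p - 1"] Suc.prems by auto
    then have "branch (\<lambda>x. \<phi> x * pair n (p - 1) (k n) k' x) \<in> G"
      using \<phi>(1) G_closed(2) by (simp flip: branch_mult)
    moreover have "\<phi> j * pair n (p - 1) (k n) k' j = k j" if "j < Suc n" for j
      using that \<phi> Suc.prems by (auto simp: pair_def less_Suc_eq)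
    moreover have "\<phi> j * pair n (p - 1) (k n) k' j = 1" if "Suc n \<le> j" "j \<noteq> p - 1" for j
      using that \<phi> by (auto simp: pair_def)
    ultimately show ?case by blast
  qed
  from this[of "p - 1"] obtain \<phi> where \<phi>: "branch \<phi> \<in> G" "\<And>j. j < p - 1 \<Longrightarrow> \<phi> j = k j"
      "\<And>j. p - 1 \<le> j \<Longrightarrow> j \<noteq> p - 1 \<Longrightarrow> \<phi> j = 1"
    by auto
  have "\<phi> j = 1" if "p \<le> j" for j
    using \<phi>(3) that p_pos by simp
  then show ?thesis using \<phi> by blast
qed

text \<open>The section values of \<open>g\<close> are divisible by \<open>p ^ s\<close>. As
  \<open>A\<close> is torsion-free, the quotients \<open>f\<close> satisfy the same two linear
  equations, so an element of \<open>R\<close> has section values \<open>f\<close>; the sections of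
  its \<open>p ^ s\<close>-th power agree with those of \<open>g\<close> modulo
  \<open>R\<close>.\<close>

lemma R_St_power_mod_RR_1:
  assumes "g \<in> R" "g \<in> St (Suc (p * s + 2))"
  shows "\<exists>h\<in>R. \<exists>\<kappa>\<in>RR 1. g = h ^ p ^ s * \<kappa>"
proof -
  let ?q = "of_nat (p ^ s) :: int poly"
  have sec: "sec g y \<in> St (p * s + 2)" if "y < p" for y
    using St_sec(2)[OF assms(2) that] .
  then have secK: "sec g y \<in> K" if "y < p" for y
    using T_St_prime_power(1) that by blast
  have "\<forall>y. \<exists>f. y < p \<longrightarrow> T (sec g y) \<doteq> ?q * f"
    using T_St_prime_power(2) sec by blast
  then obtain f where f: "\<And>y. y < p \<Longrightarrow> T (sec g y) \<doteq> ?q * f y"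
    by metis
  note lg = level_one[OF R_G[OF assms(1)] St_sec(1)[OF assms(2) p_pos] p_pos]
  have q0: "F \<doteq> 0" if "?q * F \<doteq> 0" for F
    using of_nat_cg_0[OF that] p_pos by simp
  have "?q * (\<Sum>y<p. f y) \<doteq> (\<Sum>y<p. T (sec g y))"
    unfolding sum_distrib_left using f by (intro cg_sum) (auto intro: cg_sym)
  then have sum_f: "(\<Sum>y<p. f y) \<doteq> 0"
    using cg_trans lg(5) R_K[OF assms(1)] q0 by blast
  have "?q * (\<zeta> * (\<Sum>y<p. \<zeta> ^ y * f y)) = \<zeta> * (\<Sum>y<p. \<zeta> ^ y * (?q * f y))"
    by (simp add: sum_distrib_left ac_simps)
  also have "\<dots> \<doteq> \<zeta> * (\<Sum>y<p. \<zeta> ^ y * T (sec g y))"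
    using f by (intro cg_mult_left cg_sum) (auto intro: cg_sym)
  also have "\<dots> \<doteq> T g" by (rule cg_sym[OF lg(3)])
  also have "\<dots> \<doteq> 0" using assms(1) by (simp add: R_def)
  finally have sum_zf: "\<zeta> * (\<Sum>y<p. \<zeta> ^ y * f y) \<doteq> 0" by (rule q0)
  have "\<forall>y. \<exists>k. k \<in> K \<and> T k \<doteq> f y" using T_surj by blast
  then obtain k where k: "\<And>y. k y \<in> K" "\<And>y. T (k y) \<doteq> f y" by metis
  obtain \<phi> where \<phi>: "branch \<phi> \<in> G" "\<And>j. j < p - 1 \<Longrightarrow> \<phi> j = k j" "\<And>j. p \<le> j \<Longrightarrow> \<phi> j = 1"
    using branch_with_sections[of k] k by auto
  have "\<phi> 0 \<in> K" using \<phi>(2)[of 0] k(1) p_gt_1 by simp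
  note l\<phi> = branch_level_one[OF \<phi>(1) p_pos this]
  have Suc_p: "p = Suc (p - 1)" using p_pos by simp
  have T\<phi>: "T (\<phi> y) \<doteq> f y" if "y < p" for y
  proof (cases "y < p - 1")
    case True
    then show ?thesis using \<phi>(2) k(2) by simp
  next
    case False
    then have y: "y = p - 1" using that by simp
    have split: "(\<Sum>y<p. F y) = (\<Sum>y<p - 1. F y) + F (p - 1)" for F :: "nat \<Rightarrow> int poly"
      by (subst Suc_p) (rule sum.lessThan_Suc)
    have "(\<Sum>y<p - 1. T (\<phi> y)) \<doteq> (\<Sum>y<p - 1. f y)"
      using \<phi>(2) k(2) by (intro cg_sum) auto
    \<comment> \<open>Both sums over all vertices vanish and their parts below \<open>p - 1\<close>
      agree, which determines the last value.\<close>
    from cg_diff[OF cg_trans[OF l\<phi>(3) cg_sym[OF sum_f], unfolded split] this]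
    show ?thesis by (simp add: y)
  qed
  have "\<zeta> * (\<Sum>y<p. \<zeta> ^ y * T (\<phi> y)) \<doteq> \<zeta> * (\<Sum>y<p. \<zeta> ^ y * f y)"
    using T\<phi> by (intro cg_mult_left cg_sum) auto
  then have "T (branch \<phi>) \<doteq> 0"
    using l\<phi>(2) sum_zf cg_trans by blast
  then have h: "branch \<phi> \<in> R" using l\<phi>(1) by (simp add: R_def)
  define \<rho> where "\<rho> y = inverse (\<phi> y ^ p ^ s) * sec g y" for y
  have "\<rho> y \<in> R" if "y < p" for y
  proof -
    have "\<phi> y \<in> K" using l\<phi>(4) that .
    then have "T (\<phi> y ^ p ^ s) \<doteq> ?q * f y"
      using cg_trans[OF T_power_K cg_mult_left[OF T\<phi>[OF that]]] by blast
    then have "T (\<phi> y ^ p ^ s) \<doteq> T (sec g y)"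
      using f[OF that] cg_sym cg_trans by blast
    then show ?thesis
      unfolding \<rho>_def using \<open>\<phi> y \<in> K\<close> secK[OF that] by (intro quotient_in_R) (auto intro: K_closed)
  qed
  moreover have "\<rho> y = 1" if "p \<le> y" for y
    using \<phi>(3)[OF that] sec_eq_1[OF R_G[OF assms(1)] that] by (simp add: \<rho>_def)
  ultimately have "branch \<rho> \<in> RR 1" by auto
  moreover have "g = branch \<phi> ^ p ^ s * branch \<rho>"
    using lg(2) by (simp add: \<rho>_def branch_power branch_mult)
  ultimately show ?thesis using h by blast
qed

text \<open>The case of \<open>R\<close>, applied at every vertex of level \<open>n\<close>;
  descending there uses up \<open>n\<close> levels of the stabilizer.\<close>

lemma RR_St_power_mod_RR_Suc:
  "g \<in> RR n \<Longrightarrow> g \<in> St (n + Suc (p * s + 2)) \<Longrightarrow> \<exists>h\<in>RR n. \<exists>\<kappa>\<in>RR (Suc n). g = h ^ p ^ s * \<kappa>"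
proof (induction n arbitrary: g)
  case 0
  then show ?case using R_St_power_mod_RR_1[of g s] by simp
next
  case (Suc n)
  then obtain \<rho> where \<rho>: "g = branch \<rho>" "\<And>x. x < p \<Longrightarrow> \<rho> x \<in> RR n" "\<And>x. p \<le> x \<Longrightarrow> \<rho> x = 1"
    by auto
  have "\<rho> x \<in> St (n + Suc (p * s + 2))" if "x < p" for x
    using St_sec(2)[of g "n + Suc (p * s + 2)" x] Suc.prems(2) that by (simp add: \<rho>(1))
  then have "\<forall>x. \<exists>h \<kappa>. x < p \<longrightarrow> h \<in> RR n \<and> \<kappa> \<in> RR (Suc n) \<and> \<rho> x = h ^ p ^ s * \<kappa>"
    using Suc.IH \<rho>(2) by blast
  then obtain h \<kappa> where h\<kappa>: "\<And>x. x < p \<Longrightarrow> h x \<in> RR n \<and> \<kappa> x \<in> RR (Suc n) \<and> \<rho> x = h x ^ p ^ s * \<kappa> x"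
    by metis
  define h' where "h' x = (if x < p then h x else 1)" for x
  define \<kappa>' where "\<kappa>' x = (if x < p then \<kappa> x else 1)" for x
  have "branch h' \<in> RR (Suc n)" "branch \<kappa>' \<in> RR (Suc (Suc n))"
    using h\<kappa> unfolding RR.simps(2)[of n] RR.simps(2)[of "Suc n"] h'_def \<kappa>'_def
    by (auto simp del: RR.simps)
  moreover have "g = branch h' ^ p ^ s * branch \<kappa>'"
    using h\<kappa> \<rho>(3) by (auto simp: \<rho>(1) h'_def \<kappa>'_def branch_power branch_mult fun_eq_iff)
  ultimately show ?case by blast
qed

text \<open>
  In the induction step the hypothesis is applied to the intersection of \<open>N\<close> with a level
  stabilizer, so that the factor in \<open>RR n\<close> is itself in that stabilizer.
\<close>

lemma St_subset_mult_RR: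
  assumes "is_subgroup N" "\<And>g. g \<in> G \<Longrightarrow> g ^ p ^ s \<in> N"
  shows "\<exists>m. \<forall>g\<in>St m. \<exists>\<nu>\<in>N. \<exists>\<kappa>\<in>RR n. g = \<nu> * \<kappa>"
  using assms
proof (induction n arbitrary: N s)
  case 0
  obtain m where m: "\<forall>g\<in>St m. \<exists>h\<in>K. \<exists>r\<in>R. g = h ^ p ^ s * r"
    using St_power_mod_R by blast
  then have "\<forall>g\<in>St m. \<exists>\<nu>\<in>N. \<exists>\<kappa>\<in>R. g = \<nu> * \<kappa>"
    using 0(2) K_G by metis
  then show ?case by auto
next
  case (Suc n)
  define M where "M = n + Suc (p * s + 2)"
  have "is_subgroup (N \<inter> St M)"
    using Suc.prems(1) is_subgroup_St by (rule is_subgroup_Int)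
  \<comment> \<open>The exponent \<open>p ^ s\<close> brings \<open>g\<close> into \<open>N\<close>,
    and the further \<open>p ^ M\<close> brings it into \<open>St M\<close>.\<close>
  moreover have "g ^ p ^ (s + M) \<in> N \<inter> St M" if "g \<in> G" for g
  proof -
    have "(g ^ p ^ s) ^ p ^ M \<in> N"
      by (rule is_subgroupD(4)[OF Suc.prems(1) Suc.prems(2)[OF that]])
    moreover have "(g ^ p ^ s) ^ p ^ M \<in> St M"
      by (rule power_in_St[OF G_closed(4)[OF that]])
    ultimately show ?thesis by (simp add: power_add power_mult)
  qed
  ultimately obtain m where m: "\<forall>g\<in>St m. \<exists>\<nu>\<in>N \<inter> St M. \<exists>\<kappa>\<in>RR n. g = \<nu> * \<kappa>"
    using Suc.IH[of "N \<inter> St M" "s + M"] by blast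
  have "\<exists>\<nu>\<in>N. \<exists>\<kappa>\<in>RR (Suc n). g = \<nu> * \<kappa>" if "g \<in> St (max m M)" for g
  proof -
    have g: "g \<in> St m" "g \<in> St M" using St_mono[of m "max m M"] St_mono[of M "max m M"] that by auto
    then obtain \<nu> \<kappa> where *: "\<nu> \<in> N" "\<nu> \<in> St M" "\<kappa> \<in> RR n" "g = \<nu> * \<kappa>" using m by blast
    have "\<kappa> = inverse \<nu> * g" by (simp add: *(4))
    then have "\<kappa> \<in> St M" using is_subgroupD(2,3)[OF is_subgroup_St] g(2) *(2) by blast
    then obtain h \<kappa>' where h: "h \<in> RR n" "\<kappa>' \<in> RR (Suc n)" "\<kappa> = h ^ p ^ s * \<kappa>'"
      using RR_St_power_mod_RR_Suc *(3) unfolding M_def by blast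
    have "h \<in> G" using h(1) RR_R R_G by blast
    then have "\<nu> * h ^ p ^ s \<in> N"
      using Suc.prems *(1) is_subgroupD(2) by blast
    then show ?thesis using h by (auto simp: *(4) mult.assoc[symmetric] simp del: RR.simps)
  qed
  then show ?case by blast
qed

lemma normal_contains_St:
  assumes "is_normal N G" "finite (q ` G)"
    and "\<And>g h. g \<in> G \<Longrightarrow> h \<in> G \<Longrightarrow> q g = q h \<longleftrightarrow> g * inverse h \<in> N"
    and "\<And>g. g \<in> G \<Longrightarrow> g ^ p ^ s \<in> N"
  shows "\<exists>m. St m \<subseteq> N"
proof -
  note N = is_normalD(2)[OF assms(1)]
  obtain n where "\<forall>u\<in>vertices p. length u = n \<longrightarrow> (\<forall>r\<in>R. plant u r \<in> N)"
    using finite_index_contains_plants[OF assms(1-3)] by blast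
  then have "RR n \<subseteq> N" using RR_subset[OF N] by blast
  moreover obtain m where "\<forall>g\<in>St m. \<exists>\<nu>\<in>N. \<exists>\<kappa>\<in>RR n. g = \<nu> * \<kappa>"
    using St_subset_mult_RR[OF N assms(4)] by blast
  ultimately have "g \<in> N" if "g \<in> St m" for g
    using is_subgroupD(2)[OF N] that by (metis subsetD)
  then show ?thesis by (intro exI[of _ m] subsetI)
qed

section \<open>The two congruence subgroup properties\<close>

definition val :: "tree_aut \<Rightarrow> int" where
  "val g = Polynomial.poly (T g) 2"

definition val_modulus :: int where
  "val_modulus = 2 ^ p - 1"

lemma cg_val: "f \<doteq> g \<Longrightarrow> val_modulus dvd Polynomial.poly f 2 - Polynomial.poly g 2"
proof -
  assume "f \<doteq> g"
  then obtain q where "f - g = norm_poly * q" by (auto simp: cg_def)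
  then have "Polynomial.poly f 2 - Polynomial.poly g 2 = Polynomial.poly norm_poly 2 * Polynomial.poly q 2"
    by (metis Polynomial.poly_diff Polynomial.poly_mult)
  moreover have "Polynomial.poly norm_poly 2 = val_modulus"
    using power_diff_1_eq[of "2 :: int" p]
    by (simp add: norm_poly_def Polynomial.poly_sum Polynomial.poly_power \<zeta>_def val_modulus_def)
  ultimately show ?thesis by simp
qed

lemma val_mult: "g \<in> G \<Longrightarrow> h \<in> G \<Longrightarrow> val_modulus dvd val (g * h) - (val g + 2 ^ len g * val h)"
  using cg_val[OF T_mult[of g h]] by (simp add: val_def \<zeta>_def Polynomial.poly_power)

lemma val_modulus_coprime: "coprime val_modulus (2 ^ n)"
proof -
  have "odd val_modulus" using p_pos by (simp add: val_modulus_def)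
  then show ?thesis by simp
qed

text \<open>By Fermat's congruence, here through binomial coefficients, \<open>val_modulus\<close>
  is 1 modulo \<open>p\<close>; hence it is coprime to \<open>p\<close>, and it is greater than
  1.\<close>

lemma not_val_modulus_dvd: "\<not> val_modulus dvd int (p ^ n)"
proof
  assume dvd: "val_modulus dvd int (p ^ n)"
  have "(\<Sum>k\<le>p. p choose k) = 2 + (\<Sum>k=1..<p. p choose k)"
  proof -
    have "{..p} = insert 0 (insert p {1..<p})" using p_pos by auto
    then show ?thesis using p_pos by simp
  qed
  then have "2 ^ p = 2 + (\<Sum>k=1..<p. p choose k)" by (simp add: choose_row_sum)
  moreover have "p dvd (\<Sum>k=1..<p. p choose k)"
    by (intro dvd_sum dvd_choose_prime prime_p) auto
  then obtain c where "(\<Sum>k=1..<p. p choose k) = p * c" by blast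
  ultimately have "(2 :: nat) ^ p = 2 + p * c" by simp
  then have "int (2 ^ p) = 2 + int p * int c" by simp
  then have val: "val_modulus = 1 + int p * int c" by (simp add: val_modulus_def)
  have "coprime val_modulus (int p)"
    unfolding val by (rule coprimeI) (metis dvd_add_left_iff dvd_mult2)
  then have "coprime val_modulus (int (p ^ n))" by simp
  then have "is_unit val_modulus" using dvd coprime_absorb_left by blast
  moreover have "(2 :: int) ^ 5 \<le> 2 ^ p" by (rule power_increasing) (use p_ge_5 in auto)
  ultimately show False by (simp add: val_modulus_def)
qed

definition val_stabilizer :: "tree_aut set" where
  "val_stabilizer = {g \<in> G. val_modulus dvd val g}"

text \<open>If \<open>g * h\<close> and \<open>g\<close> send 0 to the same point, then
  \<open>h\<close> fixes 0, since the linear factor, a power of 2, is invertible for the odd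
  modulus.\<close>

lemma val_stabilizer_cancel:
  assumes "g \<in> G" "h \<in> G" "val_modulus dvd val (g * h) - val g"
  shows "h \<in> val_stabilizer"
proof -
  have "val_modulus dvd (val (g * h) - val g) - (val (g * h) - (val g + 2 ^ len g * val h))"
    by (rule dvd_diff[OF assms(3) val_mult[OF assms(1,2)]])
  then have "val_modulus dvd val h"
    using val_modulus_coprime by (simp add: coprime_dvd_mult_right_iff)
  then show ?thesis using assms by (simp add: val_stabilizer_def)
qed

lemma val_one: "val_modulus dvd val 1"
  using cg_val[OF T_one] by (simp add: val_def)

lemma is_subgroup_val_stabilizer: "is_subgroup val_stabilizer"
  unfolding is_subgroup_def
proof (intro conjI ballI)
  show "1 \<in> val_stabilizer" using val_one by (simp add: val_stabilizer_def G_closed)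
  show "g * h \<in> val_stabilizer" if "g \<in> val_stabilizer" "h \<in> val_stabilizer" for g h
  proof -
    have "val_modulus dvd (val (g * h) - (val g + 2 ^ len g * val h)) + (val g + 2 ^ len g * val h)"
      using that val_mult[of g h] by (intro dvd_add) (auto simp: val_stabilizer_def)
    then show ?thesis using that by (simp add: val_stabilizer_def G_closed)
  qed
  show "inverse g \<in> val_stabilizer" if "g \<in> val_stabilizer" for g
    using that val_one by (intro val_stabilizer_cancel[of g]) (auto simp: val_stabilizer_def G_closed)
qed

text \<open>The inverse is taken because the cosets to be counted are right cosets of the stabilizer
  of 0: such a coset is determined by where the inverse of a representative sends 0.\<close>

definition val_class :: "tree_aut \<Rightarrow> int" where
  "val_class g = val (inverse g) mod val_modulus"

lemma finite_val_class: "finite (val_class ` A)"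
proof (rule finite_subset)
  have "(2 :: int) ^ 5 \<le> 2 ^ p" by (rule power_increasing) (use p_ge_5 in auto)
  then have "0 < val_modulus" by (simp add: val_modulus_def)
  then show "val_class ` A \<subseteq> {0..<val_modulus}" by (auto simp: val_class_def)
qed simp

lemma val_class_eq:
  assumes "g \<in> G" "h \<in> G" "val_class g = val_class h"
  shows "g * inverse h \<in> val_stabilizer"
proof (rule val_stabilizer_cancel)
  show "val_modulus dvd val (inverse g * (g * inverse h)) - val (inverse g)"
    using assms(3)[symmetric] by (simp add: val_class_def mod_eq_dvd_iff)
qed (use assms in \<open>auto simp: G_closed\<close>)

text \<open>The witness is \<open>gen ^ p ^ n\<close>, which acts as the translation by
  \<open>p ^ n\<close>.\<close>

lemma val_stabilizer_not_contains_St: "\<not> St n \<subseteq> val_stabilizer"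
proof
  assume "St n \<subseteq> val_stabilizer"
  then have "val_modulus dvd val (gen ^ p ^ n)"
    using power_in_St[OF K_G[OF gen_in_K]] by (auto simp: val_stabilizer_def)
  moreover have "T (gen ^ p ^ n) \<doteq> of_nat (p ^ n) * 1"
    by (rule cg_trans[OF T_power_K[OF gen_in_K] cg_mult_left[OF T_gen]])
  then have "val_modulus dvd val (gen ^ p ^ n) - int (p ^ n)"
    using cg_val by (fastforce simp: val_def Polynomial.poly_of_nat)
  ultimately have "val_modulus dvd int (p ^ n)"
    using dvd_diff[of val_modulus "val (gen ^ p ^ n)" "val (gen ^ p ^ n) - int (p ^ n)"] by simp
  then show False using not_val_modulus_dvd by blast
qed

section \<open>Transfer to \<open>GGS p\<close>\<close>

definition res :: "tree_aut \<Rightarrow> nat list \<Rightarrow> nat list" where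
  "res g = restrict (app g) (vertices p)"

lemma app_in_vertices: "g \<in> G \<Longrightarrow> v \<in> vertices p \<Longrightarrow> app g v \<in> vertices p"
proof (induction v arbitrary: g)
  case (Cons x v)
  then obtain w where "g = ev w" by (auto simp: G_def)
  then have "rt g x < p" using Cons.prems p_pos by (simp add: rt_ev)
  then show ?case using Cons sec_in_G by (simp add: app_Cons)
qed simp

lemma res_in_tree_auts: "g \<in> G \<Longrightarrow> res g \<in> tree_auts p"
  unfolding res_def
proof (rule tree_autsI)
  show "v = w" if "app g v = app g w" for v w
    using app_facts(1)[of g] that by (simp add: bij_is_inj inj_eq)
  show "app g (butlast w) = butlast (app g w)" for w
    by (simp add: butlast_conv_take app_facts)
qed (auto simp: app_in_vertices app_facts)

lemma res_in_Bij: "g \<in> G \<Longrightarrow> res g \<in> Bij (vertices p)"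
  using res_in_tree_auts by (simp add: tree_auts_def)

lemma res_mult_AutT: "g \<in> G \<Longrightarrow> h \<in> G \<Longrightarrow> res (g * h) = res g \<otimes>\<^bsub>AutT p\<^esub> res h"
  using res_in_Bij
  by (auto simp: AutT_def BijGroup_def res_def compose_def app_in_vertices fun_eq_iff)

lemma res_one_AutT: "res 1 = \<one>\<^bsub>AutT p\<^esub>"
  by (auto simp: AutT_def BijGroup_def res_def restrict_def)

lemma res_rot: "res (rot p) = ggs_a p"
proof -
  have "rot_word p v = a_word p v" if "v \<in> vertices p" for v
    using that by (cases v) (auto simp: rot_word_def)
  then show ?thesis by (auto simp: res_def ggs_a_def app_rot)
qed

lemma res_dir: "res (dir p) = ggs_b p"
proof -
  have a: "rot_word p v = a_word p v" if "v \<in> vertices p" for v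
    using that by (cases v) (auto simp: rot_word_def)
  have "dir_word p v = b_word p v" if "v \<in> vertices p" for v
    using that by (induction v) (auto simp: a)
  then show ?thesis by (auto simp: res_def ggs_b_def app_dir)
qed

lemma res_inverse_AutT: "g \<in> G \<Longrightarrow> res (inverse g) = inv\<^bsub>AutT p\<^esub> res g"
  using res_in_tree_auts[of g] res_in_tree_auts[of "inverse g"] res_mult_AutT[of "inverse g" g]
  by (intro group.inv_equality[OF group_AutT, symmetric])
    (simp_all add: G_closed res_one_AutT, simp_all add: AutT_def)

lemma carrier_GGS: "carrier (GGS p) = res ` G"
proof -
  have "f \<in> res ` G" if "f \<in> generate (AutT p) {ggs_a p, ggs_b p}" for f
    using that
  proof induction
    case one
    then show ?case using res_one_AutT G_closed(1) by (metis imageI)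
  next
    case (incl h)
    then show ?case using res_rot res_dir rot_in_G dir_in_G by (metis imageI insert_iff singletonD)
  next
    case (inv h)
    then obtain g where "g \<in> G" "h = res g"
      using res_rot res_dir rot_in_G dir_in_G by (metis insert_iff singletonD)
    then show ?case using res_inverse_AutT G_closed(3) by (metis imageI)
  next
    case (eng f h)
    then show ?case using G_closed(2) by (auto simp flip: res_mult_AutT)
  qed
  moreover have "res (ev w) \<in> generate (AutT p) {ggs_a p, ggs_b p}" for w
  proof (induction w)
    case Nil
    then show ?case by (simp add: res_one_AutT generate.one)
  next
    case (Cons l w)
    have "res (if l then dir p else rot p) \<in> generate (AutT p) {ggs_a p, ggs_b p}"
      by (intro generate.incl) (auto simp: res_rot res_dir)
    then show ?case
      using Cons res_mult_AutT rot_in_G dir_in_G by (simp add: generate.eng)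
  qed
  ultimately show ?thesis by (auto simp: GGS_def G_def)
qed

lemma mult_GGS: "g \<in> G \<Longrightarrow> h \<in> G \<Longrightarrow> res g \<otimes>\<^bsub>GGS p\<^esub> res h = res (g * h)"
  by (simp add: res_mult_AutT GGS_def)

lemma one_GGS: "\<one>\<^bsub>GGS p\<^esub> = res 1"
  by (simp add: res_one_AutT GGS_def)

lemma inv_GGS: "g \<in> G \<Longrightarrow> inv\<^bsub>GGS p\<^esub> res g = res (inverse g)"
  by (intro group.inv_equality[OF group_GGS]) (auto simp: mult_GGS one_GGS carrier_GGS G_closed)

lemma pow_GGS: "g \<in> G \<Longrightarrow> res g [^]\<^bsub>GGS p\<^esub> n = res (g ^ n)" for n :: nat
proof (induction n)
  case (Suc n)
  have "res g [^]\<^bsub>GGS p\<^esub> Suc n = res (g ^ n) \<otimes>\<^bsub>GGS p\<^esub> res g"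
    using Suc by (simp add: nat_pow_def)
  also have "\<dots> = res (g ^ n * g)" using Suc.prems by (simp add: mult_GGS G_closed)
  finally show ?case by (simp add: power_commutes)
qed (simp add: one_GGS nat_pow_def)

lemma app_res: "v \<in> vertices p \<Longrightarrow> res g v = app g v"
  by (simp add: res_def)

text \<open>Elements of \<open>G\<close> fix the letters from \<open>p\<close> on and have trivial
  sections there, so the action on \<open>vertices p\<close> determines them.\<close>

lemma res_inj: "inj_on res G"
proof (rule inj_onI)
  have one: "app g v = v" if "g \<in> G" "\<And>u. u \<in> vertices p \<Longrightarrow> app g u = u" for g v
    using that
  proof (induction v arbitrary: g)
    case (Cons x v)
    show ?case
    proof (cases "x < p")
      case True
      have *: "rt g x = x \<and> app (sec g x) u = u" if "u \<in> vertices p" for u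
        using Cons.prems(2)[of "x # u"] True that by (simp add: app_Cons)
      then have "app (sec g x) v = v"
        using Cons.IH sec_in_G Cons.prems True by blast
      then show ?thesis using *[of "[]"] by (simp add: app_Cons)
    next
      case False
      then show ?thesis using Cons.prems by (simp add: app_Cons sec_eq_1 rt_G)
    qed
  qed simp
  fix g h assume *: "g \<in> G" "h \<in> G" "res g = res h"
  have "app (g * inverse h) u = u" if "u \<in> vertices p" for u
  proof -
    have "app (inverse h) u \<in> vertices p" using * that by (simp add: app_in_vertices G_closed)
    then have "app g (app (inverse h) u) = app h (app (inverse h) u)"
      using *(3) by (metis app_res)
    then show ?thesis by (simp flip: app_mult)
  qed
  then have "g * inverse h = 1"
    using one[of "g * inverse h"] * by (intro app_eqI) (simp add: G_closed del: app_mult)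
  then show "g = h" by (rule mult_group_eq_one)
qed

lemma level_stab_GGS: "level_stab p (GGS p) n = res ` St n"
  by (auto simp: level_stab_def carrier_GGS St_def app_res)

lemma rcos_GGS:
  assumes "subgroup N (GGS p)" "g \<in> G" "h \<in> G"
  shows "N #>\<^bsub>GGS p\<^esub> res g = N #>\<^bsub>GGS p\<^esub> res h \<longleftrightarrow> res (g * inverse h) \<in> N"
proof -
  interpret group "GGS p" by (rule group_GGS)
  have c: "res g \<in> carrier (GGS p)" "res h \<in> carrier (GGS p)"
    using assms by (auto simp: carrier_GGS)
  have "res g \<in> N #>\<^bsub>GGS p\<^esub> res h \<longleftrightarrow> res g \<otimes>\<^bsub>GGS p\<^esub> inv\<^bsub>GGS p\<^esub> res h \<in> N"
    by (rule subgroup.rcos_module[OF assms(1) group_GGS c(2,1)])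
  also have "res g \<otimes>\<^bsub>GGS p\<^esub> inv\<^bsub>GGS p\<^esub> res h = res (g * inverse h)"
    using assms by (simp add: inv_GGS mult_GGS G_closed)
  finally show ?thesis
    using repr_independence[of "res g" N "res h"] rcos_self c assms(1) by metis
qed

lemma has_p_CSP_GGS: "has_p_CSP p (GGS p)"
  unfolding has_p_CSP_def
proof (intro allI impI, elim conjE)
  fix N assume N: "N \<lhd> GGS p" and p_group: "finite_p_group p (GGS p Mod N)"
  interpret N: normal N "GGS p" by (rule N)
  define N' where "N' = {g \<in> G. res g \<in> N}"
  have "is_normal N' G"
    unfolding is_normal_def is_subgroup_def
  proof (intro conjI ballI)
    show "1 \<in> N'" using N.one_closed by (simp add: N'_def G_closed flip: one_GGS)
    show "g * h \<in> N'" if "g \<in> N'" "h \<in> N'" for g h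
      using that N.m_closed by (auto simp: N'_def G_closed simp flip: mult_GGS)
    show "inverse g \<in> N'" if "g \<in> N'" for g
      using that N.m_inv_closed by (auto simp: N'_def G_closed simp flip: inv_GGS)
    show "g * h * inverse g \<in> N'" if "g \<in> G" "h \<in> N'" for g h
    proof -
      have "res g \<in> carrier (GGS p)" using that by (simp add: carrier_GGS)
      then have "res g \<otimes>\<^bsub>GGS p\<^esub> res h \<otimes>\<^bsub>GGS p\<^esub> inv\<^bsub>GGS p\<^esub> res g \<in> N"
        using that by (intro N.inv_op_closed2) (auto simp: N'_def)
      then show ?thesis using that by (auto simp: N'_def mult_GGS inv_GGS G_closed)
    qed
  qed (auto simp: N'_def)
  moreover define q where "q g = N #>\<^bsub>GGS p\<^esub> res g" for g
  have q_carrier: "q g \<in> carrier (GGS p Mod N)" if "g \<in> G" for g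
    using that by (auto simp: q_def FactGroup_def RCOSETS_def carrier_GGS)
  then have "finite (q ` G)"
    using p_group finite_subset[of "q ` G"] by (auto simp: finite_p_group_def)
  moreover have q: "q g = q h \<longleftrightarrow> g * inverse h \<in> N'" if "g \<in> G" "h \<in> G" for g h
    using rcos_GGS[OF N.subgroup_axioms that] that by (simp add: q_def N'_def G_closed)
  moreover obtain k where k: "Coset.order (GGS p Mod N) = p ^ k"
    using p_group by (auto simp: finite_p_group_def)
  have "g ^ p ^ k \<in> N'" if "g \<in> G" for g
  proof -
    have "q (g ^ p ^ k) = q g [^]\<^bsub>GGS p Mod N\<^esub> p ^ k"
      using that hom_nat_pow[OF N.r_coset_hom_Mod _ group_GGS N.factorgroup_is_group, of "res g" "p ^ k"]
      by (simp add: q_def pow_GGS carrier_GGS)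
    also have "\<dots> = \<one>\<^bsub>GGS p Mod N\<^esub>"
      using group.pow_order_eq_1[OF N.factorgroup_is_group q_carrier[OF that]] by (simp add: k)
    also have "\<dots> = N" by (simp add: FactGroup_def)
    also have "N = q 1"
      using N.subset by (simp add: q_def N.coset_mult_one flip: one_GGS)
    finally show ?thesis using q[of "g ^ p ^ k" 1] that by (simp add: G_closed)
  qed
  ultimately obtain m where "St m \<subseteq> N'"
    using normal_contains_St[of N' q k] by blast
  then have "level_stab p (GGS p) m \<subseteq> N" by (auto simp: level_stab_GGS N'_def)
  then show "\<exists>n. level_stab p (GGS p) n \<subseteq> N" ..
qed

lemma not_has_CSP_GGS: "\<not> has_CSP p (GGS p)"
proof
  assume CSP: "has_CSP p (GGS p)"
  let ?H = "res ` val_stabilizer"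
  note val_stabilizer_closed = is_subgroupD[OF is_subgroup_val_stabilizer]
  have val_stabilizer_G: "g \<in> G" if "g \<in> val_stabilizer" for g using that by (simp add: val_stabilizer_def)
  have H: "subgroup ?H (GGS p)"
  proof (rule group.subgroupI[OF group_GGS])
    show "?H \<subseteq> carrier (GGS p)" using val_stabilizer_G by (auto simp: carrier_GGS)
    show "?H \<noteq> {}" using val_stabilizer_closed(1) by blast
    show "inv\<^bsub>GGS p\<^esub> f \<in> ?H" if "f \<in> ?H" for f
      using that val_stabilizer_G val_stabilizer_closed(3) by (auto simp: inv_GGS)
    show "f \<otimes>\<^bsub>GGS p\<^esub> h \<in> ?H" if "f \<in> ?H" "h \<in> ?H" for f h
      using that val_stabilizer_G val_stabilizer_closed(2) by (auto simp: mult_GGS)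
  qed
  \<comment> \<open>One representative for each of the finitely many values of
    \<open>val_class\<close> meets every right coset.\<close>
  define rep where "rep c = (SOME g. g \<in> G \<and> val_class g = c)" for c
  have "rcosets\<^bsub>GGS p\<^esub> ?H \<subseteq> (\<lambda>c. ?H #>\<^bsub>GGS p\<^esub> res (rep c)) ` val_class ` G"
  proof
    fix C assume "C \<in> rcosets\<^bsub>GGS p\<^esub> ?H"
    then obtain g where g: "g \<in> G" "C = ?H #>\<^bsub>GGS p\<^esub> res g"
      by (auto simp: RCOSETS_def carrier_GGS)
    have rep: "rep (val_class g) \<in> G \<and> val_class (rep (val_class g)) = val_class g"
      unfolding rep_def by (rule someI_ex) (use g in auto)
    then have "g * inverse (rep (val_class g)) \<in> val_stabilizer"
      using g(1) by (intro val_class_eq) auto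
    then have "C = ?H #>\<^bsub>GGS p\<^esub> res (rep (val_class g))"
      unfolding g(2) using rep by (intro rcos_GGS[OF H g(1), THEN iffD2]) auto
    then show "C \<in> (\<lambda>c. ?H #>\<^bsub>GGS p\<^esub> res (rep c)) ` val_class ` G" using g(1) by blast
  qed
  then have "finite (rcosets\<^bsub>GGS p\<^esub> ?H)"
    using finite_val_class finite_subset finite_imageI by metis
  then obtain n where n: "level_stab p (GGS p) n \<subseteq> ?H"
    using CSP H by (auto simp: has_CSP_def)
  have "St n \<subseteq> val_stabilizer"
  proof
    fix g assume g: "g \<in> St n"
    then have "res g \<in> ?H" using n by (auto simp: level_stab_GGS)
    then show "g \<in> val_stabilizer"
      using inj_onD[OF res_inj] val_stabilizer_G St_G[OF g] by blast
  qed
  then show False using val_stabilizer_not_contains_St by blast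
qed

end

theorem corollary14:
  fixes p :: nat
  assumes "Factorial_Ring.prime p" and "p \<ge> 5"
  shows "has_p_CSP p (GGS p) \<and> \<not> has_CSP p (GGS p)"
proof -
  interpret ggs p by standard (use assms in auto)
  show ?thesis using has_p_CSP_GGS not_has_CSP_GGS by blast
qed

end
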